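(* Over ${\sf RCA}_0$, the following are equivalent: (1) ${\sf ACA}_0$. (2) If $H$ is a hypergraph with finite edges represented by a sequence of characteristic functions, then $H$ can be represented by a sequence of finite set codes for its edges.
   Context: ${\sf RCA}_0$ is the base system of second order arithmetic with recursive comprehension and $\Sigma^0_1$ induction; ${\sf ACA}_0$ is ${\sf RCA}_0$ plus arithmetical comprehension. A hypergraph consists of a set $V\subseteq\mathbb{N}$ of vertices and a collection of edges, each a subset of $V$. Edges may be represented by a sequence $\langle \chi_i\rangle_{i\in\mathbb{N}}$ of characteristic functions ($\chi_i(v)=1$ iff $v$ is in the $i$-th edge); when all edges are finite they may alternatively be represented by a sequence of natural numbers coding the finite edges as finite sets. *)

theory Defs
  imports Main
begin

text \<open>Number variables and set variables are two separate sorts, each named by natural numbers.\<close>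

datatype tm = Var nat | Zero | One | Add tm tm | Mul tm tm

datatype fm =
    Eq tm tm
  | Less tm tm
  | Mem tm nat
  | Neg fm
  | And fm fm
  | Or fm fm
  | Imp fm fm
  | AllN nat fm
  | ExN nat fm
  | AllS nat fm
  | ExS nat fm

primrec tm_vars :: "tm \<Rightarrow> nat set" where
  "tm_vars (Var x) = {x}"
| "tm_vars Zero = {}"
| "tm_vars One = {}"
| "tm_vars (Add t u) = tm_vars t \<union> tm_vars u"
| "tm_vars (Mul t u) = tm_vars t \<union> tm_vars u"

inductive bounded_fm :: "fm \<Rightarrow> bool" where
  "bounded_fm (Eq t u)"
| "bounded_fm (Less t u)"
| "bounded_fm (Mem t X)"
| "bounded_fm \<phi> \<Longrightarrow> bounded_fm (Neg \<phi>)"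
| "bounded_fm \<phi> \<Longrightarrow> bounded_fm \<psi> \<Longrightarrow> bounded_fm (And \<phi> \<psi>)"
| "bounded_fm \<phi> \<Longrightarrow> bounded_fm \<psi> \<Longrightarrow> bounded_fm (Or \<phi> \<psi>)"
| "bounded_fm \<phi> \<Longrightarrow> bounded_fm \<psi> \<Longrightarrow> bounded_fm (Imp \<phi> \<psi>)"
| "bounded_fm \<phi> \<Longrightarrow> x \<notin> tm_vars t \<Longrightarrow> bounded_fm (AllN x (Imp (Less (Var x) t) \<phi>))"
| "bounded_fm \<phi> \<Longrightarrow> x \<notin> tm_vars t \<Longrightarrow> bounded_fm (ExN x (And (Less (Var x) t) \<phi>))"

definition sigma01 :: "fm \<Rightarrow> bool" where
  "sigma01 \<phi> \<longleftrightarrow> (\<exists>x \<theta>. bounded_fm \<theta> \<and> \<phi> = ExN x \<theta>)"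

definition pi01 :: "fm \<Rightarrow> bool" where
  "pi01 \<phi> \<longleftrightarrow> (\<exists>x \<theta>. bounded_fm \<theta> \<and> \<phi> = AllN x \<theta>)"

primrec arithmetical :: "fm \<Rightarrow> bool" where
  "arithmetical (Eq t u) \<longleftrightarrow> True"
| "arithmetical (Less t u) \<longleftrightarrow> True"
| "arithmetical (Mem t X) \<longleftrightarrow> True"
| "arithmetical (Neg \<phi>) \<longleftrightarrow> arithmetical \<phi>"
| "arithmetical (And \<phi> \<psi>) \<longleftrightarrow> arithmetical \<phi> \<and> arithmetical \<psi>"
| "arithmetical (Or \<phi> \<psi>) \<longleftrightarrow> arithmetical \<phi> \<and> arithmetical \<psi>"
| "arithmetical (Imp \<phi> \<psi>) \<longleftrightarrow> arithmetical \<phi> \<and> arithmetical \<psi>"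
| "arithmetical (AllN x \<phi>) \<longleftrightarrow> arithmetical \<phi>"
| "arithmetical (ExN x \<phi>) \<longleftrightarrow> arithmetical \<phi>"
| "arithmetical (AllS X \<phi>) \<longleftrightarrow> False"
| "arithmetical (ExS X \<phi>) \<longleftrightarrow> False"

text \<open>
  A general (Henkin) structure: the number variables range over the whole type \<open>'a\<close>, which may
  be nonstandard, and the set variables range over the collection \<open>sets M\<close> of subsets of it.
\<close>

record 'a structure2 =
  zero :: 'a
  one :: 'a
  add :: "'a \<Rightarrow> 'a \<Rightarrow> 'a"
  mul :: "'a \<Rightarrow> 'a \<Rightarrow> 'a"
  less :: "'a \<Rightarrow> 'a \<Rightarrow> bool"
  sets :: "'a set set"

primrec tm_val :: "'a structure2 \<Rightarrow> (nat \<Rightarrow> 'a) \<Rightarrow> tm \<Rightarrow> 'a" where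
  "tm_val M s (Var x) = s x"
| "tm_val M s Zero = zero M"
| "tm_val M s One = one M"
| "tm_val M s (Add t u) = add M (tm_val M s t) (tm_val M s u)"
| "tm_val M s (Mul t u) = mul M (tm_val M s t) (tm_val M s u)"

primrec sat :: "'a structure2 \<Rightarrow> (nat \<Rightarrow> 'a) \<Rightarrow> (nat \<Rightarrow> 'a set) \<Rightarrow> fm \<Rightarrow> bool" where
  "sat M s S (Eq t u) \<longleftrightarrow> tm_val M s t = tm_val M s u"
| "sat M s S (Less t u) \<longleftrightarrow> less M (tm_val M s t) (tm_val M s u)"
| "sat M s S (Mem t X) \<longleftrightarrow> tm_val M s t \<in> S X"
| "sat M s S (Neg \<phi>) \<longleftrightarrow> \<not> sat M s S \<phi>"
| "sat M s S (And \<phi> \<psi>) \<longleftrightarrow> sat M s S \<phi> \<and> sat M s S \<psi>"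
| "sat M s S (Or \<phi> \<psi>) \<longleftrightarrow> sat M s S \<phi> \<or> sat M s S \<psi>"
| "sat M s S (Imp \<phi> \<psi>) \<longleftrightarrow> (sat M s S \<phi> \<longrightarrow> sat M s S \<psi>)"
| "sat M s S (AllN x \<phi>) \<longleftrightarrow> (\<forall>a. sat M (s(x := a)) S \<phi>)"
| "sat M s S (ExN x \<phi>) \<longleftrightarrow> (\<exists>a. sat M (s(x := a)) S \<phi>)"
| "sat M s S (AllS X \<phi>) \<longleftrightarrow> (\<forall>A\<in>sets M. sat M s (S(X := A)) \<phi>)"
| "sat M s S (ExS X \<phi>) \<longleftrightarrow> (\<exists>A\<in>sets M. sat M s (S(X := A)) \<phi>)"

definition basic_axioms :: "'a structure2 \<Rightarrow> bool" where
  "basic_axioms M \<longleftrightarrow>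
     (\<forall>n. add M n (one M) \<noteq> zero M) \<and>
     (\<forall>m n. add M m (one M) = add M n (one M) \<longrightarrow> m = n) \<and>
     (\<forall>m. add M m (zero M) = m) \<and>
     (\<forall>m n. add M m (add M n (one M)) = add M (add M m n) (one M)) \<and>
     (\<forall>m. mul M m (zero M) = zero M) \<and>
     (\<forall>m n. mul M m (add M n (one M)) = add M (mul M m n) m) \<and>
     (\<forall>m. \<not> less M m (zero M)) \<and>
     (\<forall>m n. less M m (add M n (one M)) \<longleftrightarrow> less M m n \<or> m = n)"

text \<open>
  The schemes are stated for all instances with all number parameters \<open>s\<close> and set parameters \<open>S\<close>.
  The values of \<open>S\<close> are fixed before the new set \<open>A\<close> is chosen; this is the usual proviso that
  the comprehension variable is not free in the formula.
\<close>

definition sigma01_induction :: "'a structure2 \<Rightarrow> bool" where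
  "sigma01_induction M \<longleftrightarrow>
     (\<forall>\<phi> x s S. sigma01 \<phi> \<and> range S \<subseteq> sets M \<longrightarrow>
        sat M (s(x := zero M)) S \<phi> \<longrightarrow>
        (\<forall>n. sat M (s(x := n)) S \<phi> \<longrightarrow> sat M (s(x := add M n (one M))) S \<phi>) \<longrightarrow>
        (\<forall>n. sat M (s(x := n)) S \<phi>))"

definition delta01_comprehension :: "'a structure2 \<Rightarrow> bool" where
  "delta01_comprehension M \<longleftrightarrow>
     (\<forall>\<phi> \<psi> x s S. sigma01 \<phi> \<and> pi01 \<psi> \<and> range S \<subseteq> sets M \<longrightarrow>
        (\<forall>n. sat M (s(x := n)) S \<phi> \<longleftrightarrow> sat M (s(x := n)) S \<psi>) \<longrightarrow>
        (\<exists>A\<in>sets M. \<forall>n. n \<in> A \<longleftrightarrow> sat M (s(x := n)) S \<phi>))"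

definition arithmetical_comprehension :: "'a structure2 \<Rightarrow> bool" where
  "arithmetical_comprehension M \<longleftrightarrow>
     (\<forall>\<phi> x s S. arithmetical \<phi> \<and> range S \<subseteq> sets M \<longrightarrow>
        (\<exists>A\<in>sets M. \<forall>n. n \<in> A \<longleftrightarrow> sat M (s(x := n)) S \<phi>))"

text \<open>
  Without \<open>sets M \<noteq> {}\<close> there would be no set assignments and the schemes would hold vacuously.
\<close>

definition RCA0_model :: "'a structure2 \<Rightarrow> bool" where
  "RCA0_model M \<longleftrightarrow> sets M \<noteq> {} \<and> basic_axioms M \<and>
     sigma01_induction M \<and> delta01_comprehension M"

definition ACA0_model :: "'a structure2 \<Rightarrow> bool" where
  "ACA0_model M \<longleftrightarrow> RCA0_model M \<and> arithmetical_comprehension M"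

text \<open>
  The pairing \<open>(i + j)\<^sup>2 + i\<close> is injective but not surjective, so the product of all numbers with
  all numbers is a proper subset of the numbers.
\<close>

definition pair :: "'a structure2 \<Rightarrow> 'a \<Rightarrow> 'a \<Rightarrow> 'a" where
  "pair M i j = add M (mul M (add M i j) (add M i j)) i"

definition product :: "'a structure2 \<Rightarrow> 'a set \<Rightarrow> 'a set \<Rightarrow> 'a set" where
  "product M A B = {pair M a b | a b. a \<in> A \<and> b \<in> B}"

definition is_function :: "'a structure2 \<Rightarrow> 'a set \<Rightarrow> 'a set \<Rightarrow> 'a set \<Rightarrow> bool" where
  "is_function M F A B \<longleftrightarrow>
     F \<in> sets M \<and> F \<subseteq> product M A B \<and> (\<forall>a\<in>A. \<exists>!b. pair M a b \<in> F)"

text \<open>A set is finite, in the sense of second order arithmetic, if it is bounded.\<close>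

definition finite_in :: "'a structure2 \<Rightarrow> 'a set \<Rightarrow> bool" where
  "finite_in M A \<longleftrightarrow> (\<exists>k. \<forall>i\<in>A. less M i k)"

definition divides :: "'a structure2 \<Rightarrow> 'a \<Rightarrow> 'a \<Rightarrow> bool" where
  "divides M a b \<longleftrightarrow> (\<exists>q. b = mul M a q)"

text \<open>
  The usual coding of finite sets in second order arithmetic: \<open>(k, (m, n))\<close> describes the set of
  all \<open>i < k\<close> such that \<open>m (i + 1) + 1\<close> divides \<open>n\<close>, and the code of a finite set is
  the least number that describes it.
\<close>

definition describes :: "'a structure2 \<Rightarrow> 'a \<Rightarrow> 'a set \<Rightarrow> bool" where
  "describes M c A \<longleftrightarrow>
     (\<exists>k m n. c = pair M k (pair M m n) \<and>
        (\<forall>i. i \<in> A \<longleftrightarrow>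
           less M i k \<and> divides M (add M (mul M m (add M i (one M))) (one M)) n))"

definition is_code_of :: "'a structure2 \<Rightarrow> 'a \<Rightarrow> 'a set \<Rightarrow> bool" where
  "is_code_of M c A \<longleftrightarrow> describes M c A \<and> (\<forall>d. less M d c \<longrightarrow> \<not> describes M d A)"

text \<open>
  A sequence of characteristic functions is, as usual, a single function of two arguments:
  \<open>\<chi>\<^sub>i(v) = \<chi>(i, v)\<close>.
\<close>

definition char_edge :: "'a structure2 \<Rightarrow> 'a set \<Rightarrow> 'a \<Rightarrow> 'a set" where
  "char_edge M \<chi> i = {v. pair M (pair M i v) (one M) \<in> \<chi>}"

definition char_hypergraph :: "'a structure2 \<Rightarrow> 'a set \<Rightarrow> 'a set \<Rightarrow> bool" where
  "char_hypergraph M V \<chi> \<longleftrightarrow>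
     is_function M \<chi> (product M UNIV UNIV) {zero M, one M} \<and>
     (\<forall>i. char_edge M \<chi> i \<subseteq> V)"

text \<open>
  The sequence \<open>c\<close> of numbers represents the hypergraph given by \<open>\<chi>\<close> if the finite sets coded by
  the terms of \<open>c\<close> are exactly the edges; the edges form a collection, so the order in which the
  two sequences enumerate them is immaterial.
\<close>

definition represented_by_codes :: "'a structure2 \<Rightarrow> 'a set \<Rightarrow> 'a set \<Rightarrow> bool" where
  "represented_by_codes M \<chi> c \<longleftrightarrow>
     is_function M c UNIV UNIV \<and>
     (\<forall>i. \<exists>j e. pair M j e \<in> c \<and> is_code_of M e (char_edge M \<chi> i)) \<and>
     (\<forall>j e. pair M j e \<in> c \<longrightarrow> (\<exists>i. is_code_of M e (char_edge M \<chi> i)))"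

definition finite_edge_coding :: "'a structure2 \<Rightarrow> bool" where
  "finite_edge_coding M \<longleftrightarrow>
     (\<forall>V\<in>sets M. \<forall>\<chi>\<in>sets M.
        char_hypergraph M V \<chi> \<and> (\<forall>i. finite_in M (char_edge M \<chi> i)) \<longrightarrow>
        (\<exists>c\<in>sets M. represented_by_codes M \<chi> c))"

end

theory Submission
  imports Defs
begin

text \<open>
  Over \<open>RCA\<^sub>0\<close> both statements are equivalent to \<open>\<Sigma>\<^sup>0\<^sub>1\<close> comprehension. By tupling the
  free variables, \<open>\<Sigma>\<^sup>0\<^sub>1\<close> comprehension makes every relation \<open>\<exists>a. P(a, x\<^sub>1, \<dots>, x\<^sub>k)\<close> with \<open>P\<close>
  bounded a bounded one with an additional set parameter, so quantifiers can be removed from an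
  arithmetical formula one by one.

  Given a code representation of every hypergraph with finite edges, let \<open>P\<close> be bounded and let the
  \<open>n\<close>-th edge consist of \<open>2n\<close> and of \<open>2x + 1\<close> for the least \<open>x\<close> with \<open>P(x, n)\<close>, if there is
  one. The even element identifies the edge independently of the order of the codes, hence
  \<open>\<exists>x. P(x, n)\<close> holds iff some code, equivalently every code, of an edge containing \<open>2n\<close> has an odd
  element. This is a \<open>\<Delta>\<^sup>0\<^sub>1\<close> definition, because all elements of a coded set are below its code.

  Conversely, a set bounded by \<open>k\<close> has a code: choose \<open>m \<noteq> 0\<close> divisible by \<open>1, \<dots>, k\<close>, so
  that the numbers \<open>m (i + 1) + 1\<close> with \<open>i < k\<close> are pairwise coprime, and let \<open>n\<close> be the
  product of those with \<open>i\<close> in the set. The map from edges to least codes is arithmetical.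
\<close>

section \<open>Bounded relations\<close>

text \<open>
  Semantic counterparts of terms and bounded formulas with number and set parameters from the
  structure. Environments are de Bruijn style: a quantifier prepends its witness.
\<close>


inductive poly_fun :: "'a structure2 \<Rightarrow> ((nat \<Rightarrow> 'a) \<Rightarrow> 'a) \<Rightarrow> bool" for M where
  poly_fun_var: "poly_fun M (\<lambda>e. e i)"
| poly_fun_const: "poly_fun M (\<lambda>e. c)"
| poly_fun_add: "poly_fun M t \<Longrightarrow> poly_fun M u \<Longrightarrow> poly_fun M (\<lambda>e. add M (t e) (u e))"
| poly_fun_mul: "poly_fun M t \<Longrightarrow> poly_fun M u \<Longrightarrow> poly_fun M (\<lambda>e. mul M (t e) (u e))"

inductive bounded_rel :: "'a structure2 \<Rightarrow> ((nat \<Rightarrow> 'a) \<Rightarrow> bool) \<Rightarrow> bool" for M where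
  bounded_rel_eq: "poly_fun M t \<Longrightarrow> poly_fun M u \<Longrightarrow> bounded_rel M (\<lambda>e. t e = u e)"
| bounded_rel_less: "poly_fun M t \<Longrightarrow> poly_fun M u \<Longrightarrow> bounded_rel M (\<lambda>e. less M (t e) (u e))"
| bounded_rel_mem: "poly_fun M t \<Longrightarrow> A \<in> sets M \<Longrightarrow> bounded_rel M (\<lambda>e. t e \<in> A)"
| bounded_rel_not: "bounded_rel M P \<Longrightarrow> bounded_rel M (\<lambda>e. \<not> P e)"
| bounded_rel_conj: "bounded_rel M P \<Longrightarrow> bounded_rel M Q \<Longrightarrow> bounded_rel M (\<lambda>e. P e \<and> Q e)"
| bounded_rel_bex_case_nat: "poly_fun M t \<Longrightarrow> bounded_rel M P \<Longrightarrow>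
    bounded_rel M (\<lambda>e. \<exists>a. less M a (t e) \<and> P (case_nat a e))"

section \<open>Closure of bounded relations under connectives and bounded quantifiers\<close>

lemma bounded_rel_disj:
  assumes "bounded_rel M P" "bounded_rel M Q"
  shows "bounded_rel M (\<lambda>e. P e \<or> Q e)"
proof -
  have "bounded_rel M (\<lambda>e. \<not> (\<not> P e \<and> \<not> Q e))"
    by (rule bounded_rel_not, rule bounded_rel_conj; rule bounded_rel_not, rule assms)
  then show ?thesis by simp
qed

lemma bounded_rel_imp:
  assumes "bounded_rel M P" "bounded_rel M Q"
  shows "bounded_rel M (\<lambda>e. P e \<longrightarrow> Q e)"
  unfolding imp_conv_disj by (rule bounded_rel_disj, rule bounded_rel_not) (rule assms)+

lemma bounded_rel_iff:
  assumes "bounded_rel M P" "bounded_rel M Q"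
  shows "bounded_rel M (\<lambda>e. P e \<longleftrightarrow> Q e)"
  unfolding iff_conv_conj_imp by (rule bounded_rel_conj; rule bounded_rel_imp, (rule assms)+)

text \<open>The introduction rule with \<open>case_nat\<close> evaluated. Separating the witness
  from the environment in \<open>P\<close> lets unification read \<open>P\<close> off a goal, so
  that whole bounded formulas can be handled by \<open>intro\<close>.\<close>

lemma bounded_rel_bex:
  assumes "poly_fun M t" "bounded_rel M (\<lambda>e. P (e 0) (\<lambda>i. e (Suc i)))"
  shows "bounded_rel M (\<lambda>e. \<exists>a. less M a (t e) \<and> P a e)"
  using bounded_rel_bex_case_nat[OF assms] by simp

lemma bounded_rel_ball:
  assumes "poly_fun M t" "bounded_rel M (\<lambda>e. P (e 0) (\<lambda>i. e (Suc i)))"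
  shows "bounded_rel M (\<lambda>e. \<forall>a. less M a (t e) \<longrightarrow> P a e)"
proof -
  have "bounded_rel M (\<lambda>e. \<not> (\<exists>a. less M a (t e) \<and> \<not> P a e))"
    by (rule bounded_rel_not, rule bounded_rel_bex, rule assms, rule bounded_rel_not, rule assms)
  then show ?thesis by simp
qed

lemma bounded_rel_const: "bounded_rel M (\<lambda>e. p)"
proof -
  have T: "bounded_rel M (\<lambda>e. zero M = zero M)"
    by (rule bounded_rel_eq[where t = "\<lambda>_. zero M" and u = "\<lambda>_. zero M"])
      (rule poly_fun_const)+
  from T bounded_rel_not[OF T] show ?thesis by (cases p) simp_all
qed

lemma poly_fun_pair:
  "poly_fun M t \<Longrightarrow> poly_fun M u \<Longrightarrow> poly_fun M (\<lambda>e. pair M (t e) (u e))"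
  unfolding pair_def by (intro poly_fun_add poly_fun_mul)

lemmas poly_fun_intros = poly_fun_var poly_fun_const poly_fun_add poly_fun_mul poly_fun_pair

lemmas bounded_rel_intros = bounded_rel_bex bounded_rel_ball bounded_rel_eq bounded_rel_less bounded_rel_mem
  bounded_rel_not bounded_rel_conj bounded_rel_disj bounded_rel_imp bounded_rel_iff

section \<open>Parallel substitution of polynomials into bounded relations\<close>

lemma poly_fun_subst:
  assumes "poly_fun M t" "\<And>i. poly_fun M (\<tau> i)"
  shows "poly_fun M (\<lambda>e. t (\<lambda>i. \<tau> i e))"
  using assms(1)
proof induction
  case (poly_fun_var i)
  show ?case by (rule assms(2))
qed (assumption | rule poly_fun.poly_fun_const poly_fun.poly_fun_add poly_fun.poly_fun_mul)+

lemma bounded_rel_subst: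
  assumes "bounded_rel M P" "\<And>i. poly_fun M (\<tau> i)"
  shows "bounded_rel M (\<lambda>e. P (\<lambda>i. \<tau> i e))"
  using assms
proof (induction arbitrary: \<tau>)
  case (bounded_rel_eq t u)
  show ?case
    by (rule bounded_rel.bounded_rel_eq[OF poly_fun_subst[OF bounded_rel_eq(1)] poly_fun_subst[OF bounded_rel_eq(2)]])
      (rule bounded_rel_eq.prems)+
next
  case (bounded_rel_less t u)
  show ?case
    by (rule bounded_rel.bounded_rel_less[OF poly_fun_subst[OF bounded_rel_less(1)] poly_fun_subst[OF bounded_rel_less(2)]])
      (rule bounded_rel_less.prems)+
next
  case (bounded_rel_mem t A)
  show ?case
    by (rule bounded_rel.bounded_rel_mem[OF poly_fun_subst[OF bounded_rel_mem(1)]])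
      (rule bounded_rel_mem)+
next
  case (bounded_rel_not P)
  show ?case by (rule bounded_rel.bounded_rel_not, rule bounded_rel_not.IH, rule bounded_rel_not.prems)
next
  case (bounded_rel_conj P Q)
  show ?case
    by (rule bounded_rel.bounded_rel_conj)
      (rule bounded_rel_conj.IH, rule bounded_rel_conj.prems)+
next
  case (bounded_rel_bex_case_nat t P)
  \<comment> \<open>The substitution lifted under the binder: entry 0 remains the bound variable,
    and \<open>\<tau>\<close> acts on the environment behind it.\<close>
  let ?\<tau> = "case_nat (\<lambda>e. e 0) (\<lambda>i e. \<tau> i (\<lambda>j. e (Suc j)))"
  have "poly_fun M (\<lambda>e. \<tau> i (\<lambda>j. e (Suc j)))" for i
    by (rule poly_fun_subst[where \<tau> = "\<lambda>j e. e (Suc j)"])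
      (rule bounded_rel_bex_case_nat.prems poly_fun_var)+
  then have "poly_fun M (?\<tau> i)" for i
    by (cases i) (simp_all add: poly_fun_var)
  then have P: "bounded_rel M (\<lambda>e. P (\<lambda>i. ?\<tau> i e))"
    by (rule bounded_rel_bex_case_nat.IH)
  have t: "poly_fun M (\<lambda>e. t (\<lambda>i. \<tau> i e))"
    by (rule poly_fun_subst[where \<tau> = \<tau>]) (rule bounded_rel_bex_case_nat)+
  have "(\<lambda>i. ?\<tau> i (case_nat a e)) = case_nat a (\<lambda>i. \<tau> i e)" for a e
    by (auto split: nat.split)
  then show ?case
    using bounded_rel.bounded_rel_bex_case_nat[OF t P] by simp
qed

text \<open>Environments are infinite, but only a finite initial segment fits into one number. This
  notion isolates the segment that has to be tupled when an unbounded quantifier is removed.\<close>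

definition supported :: "nat \<Rightarrow> ((nat \<Rightarrow> 'b) \<Rightarrow> 'c) \<Rightarrow> bool" where
  "supported N t \<longleftrightarrow> (\<forall>e e'. (\<forall>i<N. e i = e' i) \<longrightarrow> t e = t e')"

lemma supported_mono: "supported N t \<Longrightarrow> N \<le> K \<Longrightarrow> supported K t"
  unfolding supported_def by simp

lemma supported_comp: "supported N t \<Longrightarrow> supported N (\<lambda>e. h (t e))"
  unfolding supported_def by metis

lemma supported_comp2:
  assumes "supported N t" "supported K u"
  shows "\<exists>L. supported L (\<lambda>e. h (t e) (u e))"
proof -
  have "supported (max N K) t" "supported (max N K) u"
    using assms by (simp_all add: supported_mono)
  then have "supported (max N K) (\<lambda>e. h (t e) (u e))" unfolding supported_def by metis
  then show ?thesis by blast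
qed

lemma poly_fun_finite_support:
  assumes "poly_fun M t"
  shows "\<exists>N. supported N t"
  using assms
proof induction
  case (poly_fun_var i)
  show ?case by (rule exI[of _ "Suc i"]) (simp add: supported_def)
next
  case (poly_fun_const c)
  show ?case by (simp add: supported_def)
next
  case (poly_fun_add t u)
  then show ?case using supported_comp2[of _ t _ u "add M"] by blast
next
  case (poly_fun_mul t u)
  then show ?case using supported_comp2[of _ t _ u "mul M"] by blast
qed

lemma bounded_rel_finite_support:
  assumes "bounded_rel M P"
  shows "\<exists>N. supported N P"
  using assms
proof induction
  case (bounded_rel_eq t u)
  then show ?case using poly_fun_finite_support supported_comp2[of _ t _ u "(=)"] by blast
next
  case (bounded_rel_less t u)
  then show ?case using poly_fun_finite_support supported_comp2[of _ t _ u "less M"] by blast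
next
  case (bounded_rel_mem t A)
  then show ?case using poly_fun_finite_support supported_comp[of _ t "\<lambda>b. b \<in> A"] by blast
next
  case (bounded_rel_not P)
  then show ?case using supported_comp[of _ P Not] by blast
next
  case (bounded_rel_conj P Q)
  then show ?case using supported_comp2[of _ P _ Q "(\<and>)"] by blast
next
  case (bounded_rel_bex_case_nat t P)
  then obtain N K where t: "supported N t" and P: "supported K P"
    using poly_fun_finite_support by blast
  \<comment> \<open>The value is a whole predicate in \<open>a\<close>, so that
    \<open>supported_comp2\<close> can combine it with the bound \<open>t\<close> and quantify
    afterwards. The shift by \<open>case_nat\<close> does no harm: entry \<open>i\<close> of the
    extended environment comes from an entry of \<open>e\<close> below \<open>i\<close>, or is
    \<open>a\<close>.\<close>
  have "supported K (\<lambda>e a. P (case_nat a e))"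
    unfolding supported_def
  proof (intro allI impI ext)
    fix e e' :: "nat \<Rightarrow> 'a" and a
    assume "\<forall>i<K. e i = e' i"
    then have "\<forall>i<K. case_nat a e i = case_nat a e' i" by (auto split: nat.split)
    then show "P (case_nat a e) = P (case_nat a e')" using P unfolding supported_def by blast
  qed
  from supported_comp2[OF t this, of "\<lambda>b Q. \<exists>a. less M a b \<and> Q a"] show ?case .
qed

section \<open>Bounded relations are definable by bounded formulas\<close>

primrec ren_tm :: "(nat \<Rightarrow> nat) \<Rightarrow> tm \<Rightarrow> tm" where
  "ren_tm f (Var x) = Var (f x)"
| "ren_tm f Zero = Zero"
| "ren_tm f One = One"
| "ren_tm f (Add t u) = Add (ren_tm f t) (ren_tm f u)"
| "ren_tm f (Mul t u) = Mul (ren_tm f t) (ren_tm f u)"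

primrec ren_fm :: "(nat \<Rightarrow> nat) \<Rightarrow> (nat \<Rightarrow> nat) \<Rightarrow> fm \<Rightarrow> fm" where
  "ren_fm f g (Eq t u) = Eq (ren_tm f t) (ren_tm f u)"
| "ren_fm f g (Less t u) = Less (ren_tm f t) (ren_tm f u)"
| "ren_fm f g (Mem t X) = Mem (ren_tm f t) (g X)"
| "ren_fm f g (Neg \<phi>) = Neg (ren_fm f g \<phi>)"
| "ren_fm f g (And \<phi> \<psi>) = And (ren_fm f g \<phi>) (ren_fm f g \<psi>)"
| "ren_fm f g (Or \<phi> \<psi>) = Or (ren_fm f g \<phi>) (ren_fm f g \<psi>)"
| "ren_fm f g (Imp \<phi> \<psi>) = Imp (ren_fm f g \<phi>) (ren_fm f g \<psi>)"
| "ren_fm f g (AllN x \<phi>) = AllN (f x) (ren_fm f g \<phi>)"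
| "ren_fm f g (ExN x \<phi>) = ExN (f x) (ren_fm f g \<phi>)"
| "ren_fm f g (AllS X \<phi>) = AllS (g X) (ren_fm f g \<phi>)"
| "ren_fm f g (ExS X \<phi>) = ExS (g X) (ren_fm f g \<phi>)"

lemma tm_val_ren: "tm_val M s (ren_tm f t) = tm_val M (s \<circ> f) t"
  by (induction t) simp_all

lemma tm_vars_ren: "tm_vars (ren_tm f t) = f ` tm_vars t"
  by (induction t) auto

lemma fun_upd_comp_inj: "inj f \<Longrightarrow> s(f x := a) \<circ> f = (s \<circ> f)(x := a)"
  by (auto simp: inj_def)

text \<open>Bound variables are renamed together with free ones. Injectivity prevents capture: an
  update at \<open>f x\<close> then commutes with composition with \<open>f\<close>.\<close>

lemma sat_ren:
  assumes "inj f" "inj g"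
  shows "sat M s S (ren_fm f g \<phi>) \<longleftrightarrow> sat M (s \<circ> f) (S \<circ> g) \<phi>"
  by (induction \<phi> arbitrary: s S) (simp_all add: tm_val_ren fun_upd_comp_inj assms)

lemma bounded_fm_ren:
  assumes "bounded_fm \<phi>" "inj f"
  shows "bounded_fm (ren_fm f g \<phi>)"
  using assms
  by induction (auto intro!: bounded_fm.intros simp: tm_vars_ren inj_image_mem_iff)

text \<open>Even variables hold the environment, odd ones the parameters, so that the parameters of two
  formulas can be renamed apart without touching their common environment.\<close>

definition merge :: "(nat \<Rightarrow> 'b) \<Rightarrow> (nat \<Rightarrow> 'b) \<Rightarrow> nat \<Rightarrow> 'b" where
  "merge e p i = (if even i then e (i div 2) else p (i div 2))"

text \<open>The variable 2k + 1 carries parameter k. It is sent to 4k + 1, whose half 2k is where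
  \<open>merge p q\<close> keeps entry k of \<open>p\<close>; \<open>env_right\<close> sends it to
  4k + 3, which leads to entry k of \<open>q\<close>.\<close>

definition env_left :: "nat \<Rightarrow> nat" where
  "env_left i = (if even i then i else 2 * i - 1)"

definition env_right :: "nat \<Rightarrow> nat" where
  "env_right i = (if even i then i else 2 * i + 1)"

lemma inj_env_left: "inj env_left"
proof (rule injI)
  fix i j
  assume "env_left i = env_left j"
  then show "i = j"
    unfolding env_left_def by (cases "even i"; cases "even j") (auto split: if_splits elim!: evenE oddE, (presburger+)?)
qed

lemma inj_env_right: "inj env_right"
proof (rule injI)
  fix i j
  assume "env_right i = env_right j"
  then show "i = j"
    unfolding env_right_def by (cases "even i"; cases "even j") (auto split: if_splits elim!: evenE oddE, (presburger+)?)
qed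

lemma merge_env_left: "merge e (merge p q) \<circ> env_left = merge e p"
proof
  show "(merge e (merge p q) \<circ> env_left) i = merge e p i" for i
  proof (cases "even i")
    case False
    then obtain k where "i = 2 * k + 1" by (elim oddE)
    then show ?thesis by (simp add: merge_def env_left_def)
  qed (simp add: merge_def env_left_def)
qed

lemma merge_env_right: "merge e (merge p q) \<circ> env_right = merge e q"
proof
  show "(merge e (merge p q) \<circ> env_right) i = merge e q i" for i
    by (cases "even i") (auto simp: merge_def env_right_def elim!: oddE)
qed

lemma merge_double: "merge S S' \<circ> (\<lambda>i. 2 * i) = S" "merge S S' \<circ> (\<lambda>i. 2 * i + 1) = S'"
  by (auto simp: merge_def)

lemma range_merge: "range S \<subseteq> B \<Longrightarrow> range S' \<subseteq> B \<Longrightarrow> range (merge S S') \<subseteq> B"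
  by (auto simp: merge_def)

lemma poly_fun_tm:
  assumes "poly_fun M t"
  shows "\<exists>u p. \<forall>e. t e = tm_val M (merge e p) u"
  using assms
proof induction
  case (poly_fun_var i)
  show ?case by (rule exI[of _ "Var (2 * i)"]) (simp add: merge_def)
next
  case (poly_fun_const c)
  show ?case by (rule exI[of _ "Var 1"], rule exI[of _ "\<lambda>_. c"]) (simp add: merge_def)
next
  case (poly_fun_add t u)
  then obtain t' p u' q where "\<forall>e. t e = tm_val M (merge e p) t'" "\<forall>e. u e = tm_val M (merge e q) u'"
    by blast
  then show ?case
    by (intro exI[of _ "Add (ren_tm env_left t') (ren_tm env_right u')"] exI[of _ "merge p q"])
      (simp add: tm_val_ren merge_env_left merge_env_right)
next
  case (poly_fun_mul t u)
  then obtain t' p u' q where "\<forall>e. t e = tm_val M (merge e p) t'" "\<forall>e. u e = tm_val M (merge e q) u'"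
    by blast
  then show ?case
    by (intro exI[of _ "Mul (ren_tm env_left t') (ren_tm env_right u')"] exI[of _ "merge p q"])
      (simp add: tm_val_ren merge_env_left merge_env_right)
qed

text \<open>The parameters are arguments instead of being quantified away, so that two relations can
  be said to be defined with the same ones.\<close>

definition defined_by :: "'a structure2 \<Rightarrow> ((nat \<Rightarrow> 'a) \<Rightarrow> bool) \<Rightarrow> fm \<Rightarrow> (nat \<Rightarrow> 'a) \<Rightarrow> (nat \<Rightarrow> 'a set) \<Rightarrow> bool"
  where "defined_by M P \<theta> p S \<longleftrightarrow>
    bounded_fm \<theta> \<and> range S \<subseteq> sets M \<and> (\<forall>e. P e \<longleftrightarrow> sat M (merge e p) S \<theta>)"

lemma defined_by_left:
  assumes "defined_by M P \<theta> p S" "range S' \<subseteq> sets M"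
  shows "defined_by M P (ren_fm env_left (\<lambda>i. 2 * i) \<theta>) (merge p q) (merge S S')"
proof -
  have "inj (\<lambda>i::nat. 2 * i)" by (simp add: inj_def)
  then show ?thesis using assms unfolding defined_by_def
    by (simp add: bounded_fm_ren inj_env_left range_merge sat_ren merge_env_left merge_double)
qed

lemma defined_by_right:
  assumes "defined_by M P \<theta> q S'" "range S \<subseteq> sets M"
  shows "defined_by M P (ren_fm env_right (\<lambda>i. 2 * i + 1) \<theta>) (merge p q) (merge S S')"
proof -
  have "inj (\<lambda>i::nat. 2 * i + 1)" by (simp add: inj_def)
  then show ?thesis using assms merge_double(2)[of S S'] unfolding defined_by_def
    by (simp add: bounded_fm_ren inj_env_right range_merge sat_ren merge_env_right)
qed

lemma common_parameters:
  assumes "defined_by M P \<theta> p S" "defined_by M Q \<theta>' p' S'"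
  shows "\<exists>\<theta> \<theta>' p S. defined_by M P \<theta> p S \<and> defined_by M Q \<theta>' p S"
proof -
  have "range S \<subseteq> sets M" "range S' \<subseteq> sets M" using assms unfolding defined_by_def by blast+
  then show ?thesis using defined_by_left[OF assms(1)] defined_by_right[OF assms(2)] by meson
qed

text \<open>Variable 3 is free after \<open>env_left\<close>; it receives the bound variable.\<close>

definition env_shift :: "nat \<Rightarrow> nat" where
  "env_shift i = (if i = 0 then 3 else if even i then i - 2 else 2 * i - 1)"

lemma inj_env_shift: "inj env_shift"
proof (rule injI)
  fix i j
  assume "env_shift i = env_shift j"
  then show "i = j"
    unfolding env_shift_def by (cases "even i"; cases "even j") (auto split: if_splits elim!: evenE oddE, (presburger+)?)
qed

text \<open>Turns a de Bruijn binder into a quantifier over variable 3: variable 0 reads the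
  witness, the other even variables move down by 2, and the parameters land on the numbers 4k + 1,
  away from 3.\<close>

lemma merge_env_shift:
  "((merge e (merge p q))(3 := a)) \<circ> env_shift = merge (case_nat a e) p"
proof
  fix i
  show "(((merge e (merge p q))(3 := a)) \<circ> env_shift) i = merge (case_nat a e) p i"
  proof (cases "even i")
    case True
    then obtain k where "i = 2 * k" by blast
    moreover have "2 * nat \<noteq> 3" for nat :: nat by presburger
    ultimately show ?thesis by (cases k) (simp_all add: merge_def env_shift_def)
  next
    case False
    then obtain k where k: "i = 2 * k + 1" by (elim oddE)
    have "Suc (4 * k) \<noteq> 3" by presburger
    then show ?thesis using k by (simp add: merge_def env_shift_def)
  qed
qed

lemma three_notin_env_left: "3 \<notin> env_left ` A"
proof
  assume "3 \<in> env_left ` A"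
  then obtain i where "3 = env_left i" by blast
  then show False
    unfolding env_left_def by (cases "even i") (auto elim!: evenE oddE, (presburger+)?)
qed

text \<open>The bridge to the axiom schemes, which speak of formulas. Constants become values of odd
  variables and sets become values of set variables. A set of the model is needed even for relations
  without set parameters, to have a set assignment at all.\<close>

lemma bounded_rel_defined:
  assumes "bounded_rel M P" "sets M \<noteq> {}"
  shows "\<exists>\<theta> p S. defined_by M P \<theta> p S"
  using assms
proof induction
  obtain A0 where A0: "A0 \<in> sets M" using assms(2) by blast
  {
    case (bounded_rel_eq t u)
    then obtain t' p u' q where "\<forall>e. t e = tm_val M (merge e p) t'" "\<forall>e. u e = tm_val M (merge e q) u'"
      using poly_fun_tm by meson
    then show ?case unfolding defined_by_def using A0
      by (intro exI[of _ "Eq (ren_tm env_left t') (ren_tm env_right u')"] exI[of _ "merge p q"] exI[of _ "\<lambda>_. A0"])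
        (auto simp: tm_val_ren merge_env_left merge_env_right intro: bounded_fm.intros)
  next
    case (bounded_rel_less t u)
    then obtain t' p u' q where "\<forall>e. t e = tm_val M (merge e p) t'" "\<forall>e. u e = tm_val M (merge e q) u'"
      using poly_fun_tm by meson
    then show ?case unfolding defined_by_def using A0
      by (intro exI[of _ "Less (ren_tm env_left t') (ren_tm env_right u')"] exI[of _ "merge p q"] exI[of _ "\<lambda>_. A0"])
        (auto simp: tm_val_ren merge_env_left merge_env_right intro: bounded_fm.intros)
  next
    case (bounded_rel_mem t A)
    then obtain t' p where "\<forall>e. t e = tm_val M (merge e p) t'"
      using poly_fun_tm by meson
    then show ?case unfolding defined_by_def using bounded_rel_mem
      by (intro exI[of _ "Mem t' 0"] exI[of _ p] exI[of _ "\<lambda>_. A"])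
        (auto intro: bounded_fm.intros)
  next
    case (bounded_rel_not P)
    then show ?case unfolding defined_by_def
      by (metis bounded_fm.intros(4) sat.simps(4))
  next
    case (bounded_rel_conj P Q)
    then obtain \<theta> \<theta>' p S where "defined_by M P \<theta> p S" "defined_by M Q \<theta>' p S"
      using common_parameters by meson
    then have "defined_by M (\<lambda>e. P e \<and> Q e) (And \<theta> \<theta>') p S"
      unfolding defined_by_def by (auto intro: bounded_fm.intros)
    then show ?case by blast
  next
    case (bounded_rel_bex_case_nat t P)
    then obtain \<theta> p S where \<theta>: "defined_by M P \<theta> p S" by blast
    obtain t' q where t': "\<forall>e. t e = tm_val M (merge e q) t'"
      using poly_fun_tm bounded_rel_bex_case_nat by meson
    \<comment> \<open>The bound and the body must share one list of parameters before the quantifier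
      is formed.\<close>
    define r where "r = merge p q"
    obtain \<theta>' S' where \<theta>': "defined_by M P \<theta>' r S'"
    proof
      have "range S \<subseteq> sets M" using \<theta> unfolding defined_by_def by blast
      from defined_by_left[OF \<theta> this, of q] show "defined_by M P (ren_fm env_left (\<lambda>i. 2 * i) \<theta>) r (merge S S)"
        unfolding r_def .
    qed
    have t_val: "tm_val M (merge e r) (ren_tm env_right t') = t e" for e
      unfolding r_def using t' by (simp add: tm_val_ren merge_env_right)
    \<comment> \<open>One more \<open>env_left\<close> keeps variable 3 out of the bound, as
      \<open>bounded_fm\<close> demands, and puts the parameters where \<open>env_shift\<close>
      expects them.\<close>
    define u where "u = ren_tm env_left (ren_tm env_right t')"
    have u: "3 \<notin> tm_vars u" "tm_val M (merge e (merge r r)) u = t e" for e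
      unfolding u_def using t_val three_notin_env_left
      by (simp_all add: tm_vars_ren tm_val_ren[of M _ env_left] merge_env_left)
    have u': "tm_val M (s(3 := a)) u = tm_val M s u" for s a
      using u(1) by (induction u) auto
    have inj_id: "inj (\<lambda>i::nat. i)" by simp
    let ?\<theta> = "ExN 3 (And (Less (Var 3) u) (ren_fm env_shift (\<lambda>i. i) \<theta>'))"
    have "bounded_fm ?\<theta>"
      using \<theta>' u(1) unfolding defined_by_def
      by (intro bounded_fm.intros bounded_fm_ren inj_env_shift) simp_all
    moreover have "sat M (merge e (merge r r)) S' ?\<theta> \<longleftrightarrow> (\<exists>a. less M a (t e) \<and> P (case_nat a e))" for e
      using \<theta>' unfolding defined_by_def
      by (simp add: sat_ren[OF inj_env_shift inj_id] u u' merge_env_shift comp_def[of S'])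
    ultimately have "defined_by M (\<lambda>e. \<exists>a. less M a (t e) \<and> P (case_nat a e)) ?\<theta> (merge r r) S'"
      using \<theta>' unfolding defined_by_def by simp
    then show ?case by blast
  }
qed

text \<open>Entries 0 and 1 of the environment are the variables 0 and 2 after merging. So the
  quantifier binds variable 0, variable 2 holds the argument, and \<open>c\<close> fills the
  remaining entries.\<close>

lemma sat_quantified:
  assumes "defined_by M (\<lambda>e. P (e 0) (e (Suc 0))) \<theta> p S"
  shows "sat M ((merge (\<lambda>_. c) p)(2 := n)) S (ExN 0 \<theta>) \<longleftrightarrow> (\<exists>a. P a n)"
    and "sat M ((merge (\<lambda>_. c) p)(2 := n)) S (AllN 0 \<theta>) \<longleftrightarrow> (\<forall>a. P a n)"
proof -
  have upd: "(merge (\<lambda>_. c) p)(2 := n, 0 := a) =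
      merge (\<lambda>i. if i = 0 then a else if i = 1 then n else c) p" for a
    by (auto simp: merge_def fun_eq_iff)
  have "sat M (merge e p) S \<theta> \<longleftrightarrow> P (e 0) (e (Suc 0))" for e
    using assms unfolding defined_by_def by blast
  then show "sat M ((merge (\<lambda>_. c) p)(2 := n)) S (ExN 0 \<theta>) \<longleftrightarrow> (\<exists>a. P a n)"
    and "sat M ((merge (\<lambda>_. c) p)(2 := n)) S (AllN 0 \<theta>) \<longleftrightarrow> (\<forall>a. P a n)"
    unfolding sat.simps upd by simp_all
qed

section \<open>Induction and comprehension in models\<close>

locale rca0 =
  fixes M :: "'a structure2"
  assumes rca0: "RCA0_model M"
begin

abbreviation zero_M ("\<zero>") where "\<zero> \<equiv> zero M"
abbreviation one_M ("\<one>") where "\<one> \<equiv> one M"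
abbreviation add_M (infixl "\<oplus>" 65) where "x \<oplus> y \<equiv> add M x y"
abbreviation mul_M (infixl "\<otimes>" 70) where "x \<otimes> y \<equiv> mul M x y"
abbreviation less_M (infix "\<prec>" 50) where "x \<prec> y \<equiv> less M x y"

lemma sets_nonempty: "sets M \<noteq> {}"
  using rca0 by (simp add: RCA0_model_def)

lemma sigma01_induct:
  assumes "bounded_rel M (\<lambda>e. P (e 0) (e (Suc 0)))"
    and "\<exists>a. P a \<zero>" and step: "\<And>n. \<exists>a. P a n \<Longrightarrow> \<exists>a. P a (n \<oplus> \<one>)"
  shows "\<exists>a. P a n"
proof -
  obtain \<theta> p S where \<theta>: "defined_by M (\<lambda>e. P (e 0) (e (Suc 0))) \<theta> p S"
    using bounded_rel_defined[OF assms(1) sets_nonempty] by blast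
  let ?s = "merge (\<lambda>_. \<zero>) p"
  have sat: "sat M (?s(2 := n)) S (ExN 0 \<theta>) \<longleftrightarrow> (\<exists>a. P a n)" for n
    using sat_quantified(1)[OF \<theta>] .
  have "sigma01 (ExN 0 \<theta>)" "range S \<subseteq> sets M"
    using \<theta> unfolding defined_by_def sigma01_def by auto
  then have "\<forall>n. sat M (?s(2 := n)) S (ExN 0 \<theta>)"
    using rca0 assms(2) step
    unfolding RCA0_model_def sigma01_induction_def by (metis sat)
  then show ?thesis using sat by simp
qed

lemma bounded_induct [case_names bounded zero succ]:
  assumes "bounded_rel M (\<lambda>e. P (e 0))" and "P \<zero>" and "\<And>n. P n \<Longrightarrow> P (n \<oplus> \<one>)"
  shows "P n"
proof -
  \<comment> \<open>The relation is viewed as having a vacuous existential quantifier in front,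
    whose witness takes entry 0.\<close>
  have "bounded_rel M (\<lambda>e. P (e (Suc 0)))"
    using bounded_rel_subst[OF assms(1), of "\<lambda>i e. e (Suc i)"] by (simp add: poly_fun_var)
  from sigma01_induct[OF this] assms(2,3) show ?thesis by blast
qed

lemma delta01_comp:
  assumes "bounded_rel M (\<lambda>e. P (e 0) (e (Suc 0)))" "bounded_rel M (\<lambda>e. Q (e 0) (e (Suc 0)))"
    and "\<And>n. (\<exists>a. P a n) \<longleftrightarrow> (\<forall>a. Q a n)"
  shows "{n. \<exists>a. P a n} \<in> sets M"
proof -
  obtain \<theta> \<theta>' p S where \<theta>: "defined_by M (\<lambda>e. P (e 0) (e (Suc 0))) \<theta> p S"
    "defined_by M (\<lambda>e. Q (e 0) (e (Suc 0))) \<theta>' p S"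
    using bounded_rel_defined[OF assms(1) sets_nonempty] bounded_rel_defined[OF assms(2) sets_nonempty]
      common_parameters by meson
  let ?s = "merge (\<lambda>_. \<zero>) p"
  have sat: "sat M (?s(2 := n)) S (ExN 0 \<theta>) \<longleftrightarrow> (\<exists>a. P a n)"
    "sat M (?s(2 := n)) S (AllN 0 \<theta>') \<longleftrightarrow> (\<forall>a. Q a n)" for n
    using sat_quantified(1)[OF \<theta>(1)] sat_quantified(2)[OF \<theta>(2)] .
  have "sigma01 (ExN 0 \<theta>)" "pi01 (AllN 0 \<theta>')" "range S \<subseteq> sets M"
    using \<theta> unfolding defined_by_def sigma01_def pi01_def by auto
  then obtain A where "A \<in> sets M" "\<forall>n. n \<in> A \<longleftrightarrow> sat M (?s(2 := n)) S (ExN 0 \<theta>)"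
    using rca0 assms(3) unfolding RCA0_model_def delta01_comprehension_def by (metis sat)
  moreover from this have "A = {n. \<exists>a. P a n}" unfolding sat by blast
  ultimately show ?thesis by simp
qed

lemma bounded_comp:
  assumes "bounded_rel M (\<lambda>e. P (e 0))"
  shows "{n. P n} \<in> sets M"
proof -
  have "bounded_rel M (\<lambda>e. P (e (Suc 0)))"
    using bounded_rel_subst[OF assms(1), of "\<lambda>i e. e (Suc i)"] by (simp add: poly_fun_var)
  from delta01_comp[OF this this] show ?thesis by simp
qed

lemma
  shows succ_neq_zero: "n \<oplus> \<one> \<noteq> \<zero>"
    and succ_inject: "m \<oplus> \<one> = n \<oplus> \<one> \<longleftrightarrow> m = n"
    and add_zero: "m \<oplus> \<zero> = m"
    and add_succ: "m \<oplus> (n \<oplus> \<one>) = m \<oplus> n \<oplus> \<one>"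
    and mul_zero: "m \<otimes> \<zero> = \<zero>"
    and mul_succ: "m \<otimes> (n \<oplus> \<one>) = m \<otimes> n \<oplus> m"
    and not_less_zero: "\<not> m \<prec> \<zero>"
    and less_succ: "m \<prec> n \<oplus> \<one> \<longleftrightarrow> m \<prec> n \<or> m = n"
  using rca0 unfolding RCA0_model_def basic_axioms_def by blast+

section \<open>Semiring laws by bounded induction\<close>

lemma add_assoc: "a \<oplus> b \<oplus> c = a \<oplus> (b \<oplus> c)"
proof (induction c rule: bounded_induct)
  case bounded show ?case by (intro bounded_rel_intros poly_fun_intros)
qed (simp_all add: add_zero add_succ)

lemma zero_add: "\<zero> \<oplus> a = a"
proof (induction a rule: bounded_induct)
  case bounded show ?case by (intro bounded_rel_intros poly_fun_intros)
qed (simp_all add: add_zero add_succ)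

lemma one_add: "\<one> \<oplus> a = a \<oplus> \<one>"
proof (induction a rule: bounded_induct)
  case bounded show ?case by (intro bounded_rel_intros poly_fun_intros)
qed (simp_all add: add_zero zero_add add_succ)

lemma add_commute: "a \<oplus> b = b \<oplus> a"
proof (induction b rule: bounded_induct)
  case bounded show ?case by (intro bounded_rel_intros poly_fun_intros)
next
  case (succ n)
  then show ?case by (metis add_assoc one_add)
qed (simp add: add_zero zero_add)

lemma distrib_left: "a \<otimes> (b \<oplus> c) = a \<otimes> b \<oplus> a \<otimes> c"
proof (induction c rule: bounded_induct)
  case bounded show ?case by (intro bounded_rel_intros poly_fun_intros)
qed (simp_all add: add_zero mul_zero mul_succ add_assoc[symmetric])

lemma mul_assoc: "a \<otimes> b \<otimes> c = a \<otimes> (b \<otimes> c)"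
proof (induction c rule: bounded_induct)
  case bounded show ?case by (intro bounded_rel_intros poly_fun_intros)
next
  case (succ n)
  then show ?case by (simp add: mul_succ distrib_left[of a "b \<otimes> n" b])
qed (simp add: mul_zero)

lemma zero_mul: "\<zero> \<otimes> a = \<zero>"
proof (induction a rule: bounded_induct)
  case bounded show ?case by (intro bounded_rel_intros poly_fun_intros)
qed (simp_all add: add_zero mul_zero mul_succ)

lemma one_mul: "\<one> \<otimes> a = a"
proof (induction a rule: bounded_induct)
  case bounded show ?case by (intro bounded_rel_intros poly_fun_intros)
qed (simp_all add: add_zero mul_zero mul_succ)

lemma succ_mul: "(a \<oplus> \<one>) \<otimes> b = a \<otimes> b \<oplus> b"
proof (induction b rule: bounded_induct)
  case bounded show ?case by (intro bounded_rel_intros poly_fun_intros)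
next
  case (succ n)
  then have "(a \<oplus> \<one>) \<otimes> (n \<oplus> \<one>) = a \<otimes> n \<oplus> (n \<oplus> a) \<oplus> \<one>"
    by (simp add: mul_succ add_assoc)
  then show ?case by (simp add: mul_succ add_assoc add_commute[of n a])
qed (simp add: mul_zero add_zero)

lemma mul_commute: "a \<otimes> b = b \<otimes> a"
proof (induction b rule: bounded_induct)
  case bounded show ?case by (intro bounded_rel_intros poly_fun_intros)
qed (simp_all add: mul_zero zero_mul mul_succ succ_mul)

lemma zero_neq_one: "\<zero> \<noteq> \<one>"
  using succ_neq_zero[of \<zero>] by (simp add: zero_add)

lemma distrib_right: "(a \<oplus> b) \<otimes> c = a \<otimes> c \<oplus> b \<otimes> c"
  using distrib_left[of c a b] mul_commute by metis

text \<open>Provides normalization rules for polynomial identities, as needed for pairs and for the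
  Bezout identities.\<close>

sublocale ar: comm_semiring_1 where plus = "add M" and zero = "\<zero>" and times = "mul M" and one = "\<one>"
  by unfold_locales (fact add_assoc add_commute zero_add mul_assoc mul_commute one_mul
    zero_mul mul_zero distrib_right zero_neq_one)+

section \<open>Order and pairing\<close>

lemma add_left_cancel: "a \<oplus> b = a \<oplus> c \<longleftrightarrow> b = c"
proof (induction a rule: bounded_induct)
  case bounded show ?case by (intro bounded_rel_intros poly_fun_intros bounded_rel_const)
next
  case (succ n)
  then show ?case by (metis add_assoc one_add succ_inject)
qed (simp add: zero_add)

lemma succ_less_succ: "m \<prec> n \<Longrightarrow> m \<oplus> \<one> \<prec> n \<oplus> \<one>"
proof (induction n rule: bounded_induct)
  case bounded show ?case by (intro bounded_rel_intros poly_fun_intros)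
qed (auto simp: not_less_zero less_succ)

lemma zero_less_succ: "\<zero> \<prec> n \<oplus> \<one>"
proof (induction n rule: bounded_induct)
  case bounded show ?case by (intro bounded_rel_intros poly_fun_intros)
next
  case zero show ?case using less_succ by blast
qed (simp add: less_succ)

lemma less_add_succ: "m \<prec> m \<oplus> d \<oplus> \<one>"
proof (induction d rule: bounded_induct)
  case bounded show ?case by (intro bounded_rel_intros poly_fun_intros)
next
  case zero then show ?case by (simp add: add_zero less_succ)
next
  case (succ n)
  then show ?case by (simp only: add_succ less_succ[of m "m \<oplus> n \<oplus> \<one>"] simp_thms)
qed

text \<open>The difference \<open>d\<close> comes without a bound, so the forward direction uses
  \<open>\<Sigma>\<^sup>0\<^sub>1\<close> induction. The implication stands under the quantifier to
  keep the matrix bounded; \<open>d\<close> is arbitrary when \<open>m\<close> is not below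
  \<open>n\<close>.\<close>

lemma less_iff_ex_add: "m \<prec> n \<longleftrightarrow> (\<exists>d. n = m \<oplus> d \<oplus> \<one>)"
proof
  have "\<exists>d. m \<prec> n \<longrightarrow> n = m \<oplus> d \<oplus> \<one>"
  proof (induction n rule: sigma01_induct)
    case 1 show ?case by (intro bounded_rel_intros poly_fun_intros)
  next
    case 2 show ?case by (simp add: not_less_zero)
  next
    case (3 n)
    then obtain d where d: "m \<prec> n \<longrightarrow> n = m \<oplus> d \<oplus> \<one>" by blast
    show ?case
    proof (cases "m \<prec> n")
      case True
      then have "n \<oplus> \<one> = m \<oplus> (d \<oplus> \<one>) \<oplus> \<one>" using d by (simp add: add_assoc)
      then show ?thesis by blast
    next
      case False
      then show ?thesis by (metis less_succ add_zero)
    qed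
  qed
  then show "m \<prec> n \<Longrightarrow> \<exists>d. n = m \<oplus> d \<oplus> \<one>" by blast
qed (auto simp: less_add_succ)

lemma zero_or_succ: "n = \<zero> \<or> (\<exists>m. n = m \<oplus> \<one>)"
proof -
  have "\<zero> \<prec> n \<or> \<zero> = n"
    using zero_less_succ[of n] less_succ by blast
  then show ?thesis by (metis less_iff_ex_add)
qed

lemma add_eq_zero: "a \<oplus> b = \<zero> \<longleftrightarrow> a = \<zero> \<and> b = \<zero>"
  by (metis zero_or_succ add_succ succ_neq_zero add_zero)

lemma less_trans: "a \<prec> b \<Longrightarrow> b \<prec> c \<Longrightarrow> a \<prec> c"
  unfolding less_iff_ex_add by (metis add_assoc)

lemma less_linear: "a \<prec> b \<or> a = b \<or> b \<prec> a"
proof (induction a rule: bounded_induct)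
  case bounded show ?case by (intro bounded_rel_intros poly_fun_intros)
next
  case zero show ?case using zero_less_succ[of b] less_succ by blast
next
  case (succ n)
  then show ?case using less_succ succ_less_succ by blast
qed

lemma less_succ_add: "m \<prec> m \<oplus> d \<oplus> \<one>" "m \<prec> d \<oplus> m \<oplus> \<one>"
  using less_add_succ add_commute by metis+

lemma less_succ_iff_ex_add: "m \<prec> n \<oplus> \<one> \<longleftrightarrow> (\<exists>d. n = m \<oplus> d)"
  unfolding less_iff_ex_add succ_inject by blast

lemma less_succ_trans: "a \<prec> b \<oplus> \<one> \<Longrightarrow> b \<prec> c \<oplus> \<one> \<Longrightarrow> a \<prec> c \<oplus> \<one>"
  unfolding less_succ using less_trans by (elim disjE) simp_all

lemma less_succ_mul:
  assumes "b \<noteq> \<zero>"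
  shows "a \<prec> a \<otimes> b \<oplus> \<one>"
proof -
  obtain c where "b = c \<oplus> \<one>" using zero_or_succ assms by blast
  then have "a \<otimes> b = a \<oplus> a \<otimes> c" by (simp add: mul_succ add_commute)
  then show ?thesis using less_succ_iff_ex_add by blast
qed

lemma pair_inject: "pair M i j = pair M i' j' \<longleftrightarrow> i = i' \<and> j = j'"
proof
  have not_less: False if eq: "pair M i j = pair M i' j'" and lt: "i \<oplus> j \<prec> i' \<oplus> j'" for i j i' j'
  proof -
    obtain d where d: "i' \<oplus> j' = i \<oplus> j \<oplus> d \<oplus> \<one>" using lt unfolding less_iff_ex_add by blast
    let ?s = "i \<oplus> j"
    \<comment> \<open>One less than the difference of the two pairs, written without
      subtraction.\<close>
    let ?r = "?s \<otimes> (d \<oplus> \<one>) \<oplus> d \<otimes> (?s \<oplus> d \<oplus> \<one>) \<oplus> d \<oplus> j \<oplus> i'"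
    have "pair M i' j' = ?s \<otimes> ?s \<oplus> (i \<oplus> (?r \<oplus> \<one>))"
      unfolding pair_def d by (simp add: ar.distrib_left ar.distrib_right ar.add_ac ar.mult_ac)
    moreover have "pair M i j = ?s \<otimes> ?s \<oplus> (i \<oplus> \<zero>)"
      unfolding pair_def by (simp add: add_zero)
    ultimately have "?r \<oplus> \<one> = \<zero>" using eq add_left_cancel by metis
    then show False using succ_neq_zero by blast
  qed
  assume eq: "pair M i j = pair M i' j'"
  then have s: "i \<oplus> j = i' \<oplus> j'" using not_less less_linear by metis
  then have "i = i'" using eq add_left_cancel unfolding pair_def by metis
  then show "i = i' \<and> j = j'" using s add_left_cancel by metis
qed simp

text \<open>Quantifiers over the components of a given number can thus be bounded by its
  successor.\<close>

lemma pair_bounds: "i \<prec> pair M i j \<oplus> \<one>" "j \<prec> pair M i j \<oplus> \<one>"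
proof -
  show "i \<prec> pair M i j \<oplus> \<one>" unfolding pair_def by (rule less_succ_add)
  consider "j = \<zero>" | m where "j = m \<oplus> \<one>" using zero_or_succ by blast
  then show "j \<prec> pair M i j \<oplus> \<one>"
  proof cases
    case 1 then show ?thesis using zero_less_succ by simp
  next
    case 2
    have "pair M i j = j \<oplus> ((i \<oplus> j) \<otimes> (i \<oplus> m) \<oplus> i \<oplus> i)"
      unfolding pair_def 2 by (simp add: ar.distrib_left ar.distrib_right ar.add_ac ar.mult_ac)
    then show ?thesis using less_succ_iff_ex_add by blast
  qed
qed

text \<open>Without a least element, induction on the bounded statement that no \<open>k\<close>
  below \<open>n\<close> satisfies \<open>P\<close> would exclude every number.\<close>

lemma bounded_least:
  assumes "bounded_rel M (\<lambda>e. P (e 0))" "P n"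
  shows "\<exists>m. P m \<and> (\<forall>k. k \<prec> m \<longrightarrow> \<not> P k)"
proof (rule ccontr)
  assume no: "\<not> ?thesis"
  have "\<forall>k. k \<prec> n \<longrightarrow> \<not> P k" for n
  proof (induction n rule: bounded_induct)
    case bounded
    have "bounded_rel M (\<lambda>e. P (e 0))" by fact
    then show ?case by (intro bounded_rel_intros poly_fun_intros)
  next
    case (succ n)
    then show ?case using no less_succ by blast
  qed (simp add: not_less_zero)
  then show False using assms(2) less_add_succ by blast
qed

section \<open>Even and odd numbers\<close>

lemma double_inject: "a \<oplus> a = b \<oplus> b \<longleftrightarrow> a = b"
proof
  have "a \<oplus> a \<noteq> b \<oplus> b" if lt: "a \<prec> b" for a b
  proof -
    obtain d where "b = a \<oplus> d \<oplus> \<one>" using lt unfolding less_iff_ex_add by blast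
    then have "b \<oplus> b = a \<oplus> a \<oplus> (d \<oplus> d \<oplus> \<one> \<oplus> \<one>)" by (simp add: ar.add_ac)
    then show ?thesis by (metis add_left_cancel add_zero succ_neq_zero)
  qed
  then show "a \<oplus> a = b \<oplus> b \<Longrightarrow> a = b" using less_linear by metis
qed simp

lemma double_neq_succ_double: "a \<oplus> a \<noteq> b \<oplus> b \<oplus> \<one>"
proof (cases "a \<prec> b \<oplus> \<one>")
  case True
  then obtain d where "b = a \<oplus> d" using less_succ_iff_ex_add by blast
  then have "b \<oplus> b \<oplus> \<one> = a \<oplus> a \<oplus> (d \<oplus> d \<oplus> \<one>)" by (simp add: ar.add_ac)
  then show ?thesis by (metis add_left_cancel add_zero succ_neq_zero)
next
  case False
  then have "b \<prec> a" using less_succ less_linear by blast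
  then obtain d where "a = b \<oplus> d \<oplus> \<one>" using less_iff_ex_add by blast
  then have "a \<oplus> a = b \<oplus> b \<oplus> \<one> \<oplus> (d \<oplus> d \<oplus> \<one>)" by (simp add: ar.add_ac)
  then show ?thesis by (metis add_left_cancel add_zero succ_neq_zero)
qed

section \<open>Unbounded quantifiers\<close>

lemma bounded_rel_tl:
  "bounded_rel M P \<Longrightarrow> bounded_rel M (\<lambda>e. P (\<lambda>i. e (Suc i)))"
  by (rule bounded_rel_subst[where \<tau> = "\<lambda>i e. e (Suc i)"]) (auto intro: poly_fun_var)

primrec tuple :: "nat \<Rightarrow> (nat \<Rightarrow> 'a) \<Rightarrow> 'a" where
  "tuple 0 f = \<zero>"
| "tuple (Suc N) f = pair M (tuple N f) (f N)"

lemma tuple_eq_iff: "tuple N f = tuple N g \<longleftrightarrow> (\<forall>i<N. f i = g i)"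
  by (induction N) (auto simp: pair_inject less_Suc_eq)

lemma poly_fun_tuple: "poly_fun M (tuple N)"
  by (induction N) (auto intro: poly_fun_intros)

definition join :: "nat \<Rightarrow> (nat \<Rightarrow> 'a) \<Rightarrow> (nat \<Rightarrow> 'a) \<Rightarrow> nat \<Rightarrow> 'a" where
  "join N f g i = (if i < N then f i else g (i - N))"

lemma join_zero: "join 0 f g = g"
  by (auto simp: join_def)

lemma join_Suc: "join (Suc N) f g = join N f (case_nat (f N) g)"
proof
  fix i
  consider "i < N" | "i = N" | k where "i = Suc (N + k)" using less_imp_Suc_add by (metis not_less_iff_gr_or_eq)
  then show "join (Suc N) f g i = join N f (case_nat (f N) g) i"
    by cases (auto simp: join_def split: nat.split)
qed

lemma join_cong: "(\<And>i. i < N \<Longrightarrow> f i = f' i) \<Longrightarrow> join N f g = join N f' g"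
  by (auto simp: join_def)

text \<open>Only the first \<open>N\<close> values of \<open>f\<close> matter. They are peeled off
  the tuple one pair at a time, and by \<open>pair_bounds\<close> each peeling costs only bounded
  quantifiers.\<close>

lemma bounded_rel_untuple:
  assumes P: "bounded_rel M P"
  shows "bounded_rel M (\<lambda>e. \<exists>f. e 0 = tuple N f \<and> P (join N f (\<lambda>i. e (Suc i))))"
proof (induction N)
  case 0
  have "bounded_rel M (\<lambda>e. e 0 = \<zero> \<and> P (\<lambda>i. e (Suc i)))"
    by (intro bounded_rel_conj bounded_rel_eq poly_fun_var poly_fun_const bounded_rel_tl[OF P])
  then show ?case by (simp add: join_zero)
next
  case (Suc N)
  define Q where "Q = (\<lambda>e. \<exists>f. e 0 = tuple N f \<and> P (join N f (\<lambda>i. e (Suc i))))"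
  have Q: "bounded_rel M Q" unfolding Q_def by (rule Suc)
  \<comment> \<open>With the shorter tuple \<open>y\<close> quantified before the entry
    \<open>a\<close>, entry 0 is \<open>a\<close> and entry 1 is \<open>y\<close>. The substitution
    swaps them and drops the original tuple at entry 2.\<close>
  have "poly_fun M (\<lambda>e. case_nat (e (Suc 0)) (case_nat (e 0) (\<lambda>i. e (Suc (Suc (Suc i))))) i)" for i
  proof (cases i)
    case (Suc k)
    then show ?thesis by (cases k) (simp_all add: poly_fun_var)
  qed (simp add: poly_fun_var)
  then have Q': "bounded_rel M (\<lambda>e. Q (case_nat (e (Suc 0)) (case_nat (e 0) (\<lambda>i. e (Suc (Suc (Suc i)))))))"
    by (rule bounded_rel_subst[OF Q])
  have "bounded_rel M (\<lambda>e. \<exists>y. y \<prec> e 0 \<oplus> \<one> \<and> (\<exists>a. a \<prec> e 0 \<oplus> \<one> \<and>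
      (e 0 = pair M y a \<and> Q (case_nat y (case_nat a (\<lambda>i. e (Suc i)))))))"
    by (intro bounded_rel_bex bounded_rel_conj bounded_rel_eq poly_fun_intros Q')
  moreover have "(\<exists>y. y \<prec> e 0 \<oplus> \<one> \<and> (\<exists>a. a \<prec> e 0 \<oplus> \<one> \<and>
      (e 0 = pair M y a \<and> Q (case_nat y (case_nat a (\<lambda>i. e (Suc i))))))) \<longleftrightarrow>
    (\<exists>f. e 0 = tuple (Suc N) f \<and> P (join (Suc N) f (\<lambda>i. e (Suc i))))" (is "?L \<longleftrightarrow> ?R") for e
  proof
    assume ?L
    then obtain y a f where *: "e 0 = pair M y a" "y = tuple N f" "P (join N f (case_nat a (\<lambda>i. e (Suc i))))"
      unfolding Q_def by auto
    let ?f = "f(N := a)"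
    have "tuple N ?f = tuple N f" by (simp add: tuple_eq_iff)
    moreover have "join N ?f g = join N f g" for g by (rule join_cong) simp
    ultimately have "e 0 = tuple (Suc N) ?f \<and> P (join (Suc N) ?f (\<lambda>i. e (Suc i)))"
      using * by (simp add: join_Suc)
    then show ?R by blast
  next
    assume ?R
    then obtain f where *: "e 0 = pair M (tuple N f) (f N)" "P (join N f (case_nat (f N) (\<lambda>i. e (Suc i))))"
      by (auto simp: join_Suc)
    then have "Q (case_nat (tuple N f) (case_nat (f N) (\<lambda>i. e (Suc i))))" unfolding Q_def by auto
    then show ?L using * pair_bounds by metis
  qed
  ultimately show ?case by simp
qed

text \<open>Number and set parameters are already built into \<open>bounded_rel\<close>, so a binary
  relation is general enough.\<close>

definition sigma01_comprehension :: bool where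
  "sigma01_comprehension \<longleftrightarrow>
    (\<forall>P. bounded_rel M (\<lambda>e. P (e 0) (e (Suc 0))) \<longrightarrow> {n. \<exists>a. P a n} \<in> sets M)"

text \<open>Comprehension yields the set of all tuples for which a witness exists. The quantified
  relation then becomes an atom, membership of the polynomial \<open>tuple N\<close> in this
  set.\<close>

lemma bounded_rel_ex_case_nat:
  assumes comp: sigma01_comprehension and P: "bounded_rel M P"
  shows "bounded_rel M (\<lambda>e. \<exists>a. P (case_nat a e))"
proof -
  obtain N where N: "supported N P" using bounded_rel_finite_support[OF P] by blast
  \<comment> \<open>The quantified value moves from the front to position \<open>N\<close>, just
    behind the entries that the tuple supplies.\<close>
  define P' where "P' = (\<lambda>e. P (case_nat (e N) e))"
  have "poly_fun M (\<lambda>e. case_nat (e N) e i)" for i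
    by (cases i) (simp_all add: poly_fun_var)
  then have P': "bounded_rel M P'"
    unfolding P'_def by (rule bounded_rel_subst[OF P])
  have P'_join: "P' (join N f g) \<longleftrightarrow> P (case_nat (g 0) f)" for f g
    unfolding P'_def by (rule N[unfolded supported_def, rule_format]) (auto simp: join_def split: nat.split)
  let ?R = "\<lambda>a n. \<exists>f. n = tuple N f \<and> P (case_nat a f)"
  have "bounded_rel M (\<lambda>e. ?R (e (Suc 0)) (e 0))"
    using bounded_rel_untuple[OF P', of N] unfolding P'_join .
  then have "bounded_rel M (\<lambda>e. ?R (e 0) (e (Suc 0)))"
    using bounded_rel_subst[where \<tau> = "\<lambda>i e. e (1 - i)" and P = "\<lambda>e. ?R (e (Suc 0)) (e 0)" and M = M]
    by (simp add: poly_fun_var)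
  then have A: "{n. \<exists>a. ?R a n} \<in> sets M" (is "?A \<in> _")
    using comp unfolding sigma01_comprehension_def by (elim allE[where x = ?R]) simp
  have "tuple N e \<in> ?A \<longleftrightarrow> (\<exists>a. P (case_nat a e))" for e
  proof -
    have "P (case_nat a e) \<longleftrightarrow> P (case_nat a f)" if "tuple N e = tuple N f" for a f
    proof (rule N[unfolded supported_def, rule_format])
      show "case_nat a e i = case_nat a f i" if "i < N" for i
        using that \<open>tuple N e = tuple N f\<close> by (cases i) (simp_all add: tuple_eq_iff)
    qed
    then show ?thesis by blast
  qed
  moreover have "bounded_rel M (\<lambda>e. tuple N e \<in> ?A)"
    by (rule bounded_rel_mem[OF poly_fun_tuple A])
  ultimately show ?thesis by simp
qed

lemma bounded_rel_ex:
  assumes sigma01_comprehension "bounded_rel M (\<lambda>e. P (e 0) (\<lambda>i. e (Suc i)))"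
  shows "bounded_rel M (\<lambda>e. \<exists>a. P a e)"
  using bounded_rel_ex_case_nat[OF assms] by simp

lemma bounded_rel_all:
  assumes sigma01_comprehension "bounded_rel M (\<lambda>e. P (e 0) (\<lambda>i. e (Suc i)))"
  shows "bounded_rel M (\<lambda>e. \<forall>a. P a e)"
proof -
  have "bounded_rel M (\<lambda>e. \<not> (\<exists>a. \<not> P a e))"
    by (rule bounded_rel_not, rule bounded_rel_ex, rule assms, rule bounded_rel_not, rule assms)
  then show ?thesis by simp
qed

section \<open>Arithmetical formulas as bounded relations\<close>

lemma poly_fun_tm_val: "poly_fun M (\<lambda>s. tm_val M s t)"
  by (induction t) (simp_all add: poly_fun.intros)

text \<open>Translates a named quantified variable into de Bruijn form: the witness arrives as entry
  0 and is written to position \<open>x\<close>.\<close>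

lemma bounded_rel_upd:
  assumes "bounded_rel M P"
  shows "bounded_rel M (\<lambda>e. P ((\<lambda>i. e (Suc i))(x := e 0)))"
proof -
  have "poly_fun M (\<lambda>e. if i = x then e 0 else e (Suc i))" for i
    by (cases "i = x") (simp_all add: poly_fun_var)
  from bounded_rel_subst[OF assms this] show ?thesis by (simp add: fun_upd_def)
qed

lemma bounded_rel_sat:
  assumes comp: sigma01_comprehension and S: "range S \<subseteq> sets M"
  shows "arithmetical \<phi> \<Longrightarrow> bounded_rel M (\<lambda>s. sat M s S \<phi>)"
proof (induction \<phi>)
  case (Eq t u)
  show ?case unfolding sat.simps by (rule bounded_rel_eq poly_fun_tm_val)+
next
  case (Less t u)
  show ?case unfolding sat.simps by (rule bounded_rel_less poly_fun_tm_val)+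
next
  case (Mem t X)
  show ?case unfolding sat.simps using S by (intro bounded_rel_mem poly_fun_tm_val) blast
next
  case (AllN x \<phi>)
  then have "bounded_rel M (\<lambda>s. sat M s S \<phi>)" by simp
  from bounded_rel_upd[OF this] show ?case unfolding sat.simps by (rule bounded_rel_all[OF comp])
next
  case (ExN x \<phi>)
  then have "bounded_rel M (\<lambda>s. sat M s S \<phi>)" by simp
  from bounded_rel_upd[OF this] show ?case unfolding sat.simps by (rule bounded_rel_ex[OF comp])
next
  case (Neg \<phi>) then show ?case by (simp add: bounded_rel_not)
next
  case (And \<phi> \<psi>) then show ?case by (simp add: bounded_rel_conj)
next
  case (Or \<phi> \<psi>) then show ?case by (simp add: bounded_rel_disj)
next
  case (Imp \<phi> \<psi>) then show ?case by (simp add: bounded_rel_imp)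
qed simp_all

lemma arithmetical_comprehension_iff_sigma01:
  "arithmetical_comprehension M \<longleftrightarrow> sigma01_comprehension"
proof
  assume comp: sigma01_comprehension
  show "arithmetical_comprehension M"
    unfolding arithmetical_comprehension_def
  proof (intro allI impI)
    fix \<phi> and x :: nat and s and S :: "nat \<Rightarrow> 'a set"
    assume "arithmetical \<phi> \<and> range S \<subseteq> sets M"
    then have "bounded_rel M (\<lambda>s. sat M s S \<phi>)" using bounded_rel_sat[OF comp] by blast
    moreover have "poly_fun M (\<lambda>e. if i = x then e 0 else s i)" for i
      by (cases "i = x") (simp_all add: poly_fun_var poly_fun_const)
    ultimately have "bounded_rel M (\<lambda>e. sat M (\<lambda>i. if i = x then e 0 else s i) S \<phi>)"
      by (rule bounded_rel_subst[where P = "\<lambda>s. sat M s S \<phi>"])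
    then have "bounded_rel M (\<lambda>e. sat M (s(x := e 0)) S \<phi>)" by (simp add: fun_upd_def)
    from bounded_comp[OF this]
    show "\<exists>A\<in>sets M. \<forall>n. n \<in> A \<longleftrightarrow> sat M (s(x := n)) S \<phi>" by (rule bexI[rotated]) (simp add: fun_upd_def)
  qed
next
  assume ac: "arithmetical_comprehension M"
  show sigma01_comprehension
    unfolding sigma01_comprehension_def
  proof (intro allI impI)
    fix P
    assume "bounded_rel M (\<lambda>e. P (e 0) (e (Suc 0)))"
    then obtain \<theta> p S where \<theta>: "defined_by M (\<lambda>e. P (e 0) (e (Suc 0))) \<theta> p S"
      using bounded_rel_defined[OF _ sets_nonempty] by blast
    let ?s = "merge (\<lambda>_. \<zero>) p"
    have sat: "sat M (?s(2 := n)) S (ExN 0 \<theta>) \<longleftrightarrow> (\<exists>a. P a n)" for n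
      using sat_quantified(1)[OF \<theta>] .
    have "bounded_fm \<theta> \<Longrightarrow> arithmetical \<theta>"
      by (induction rule: bounded_fm.induct) simp_all
    then have "arithmetical (ExN 0 \<theta>) \<and> range S \<subseteq> sets M"
      using \<theta> unfolding defined_by_def by simp
    then obtain A where "A \<in> sets M" "\<forall>n. n \<in> A \<longleftrightarrow> sat M (?s(2 := n)) S (ExN 0 \<theta>)"
      using ac unfolding arithmetical_comprehension_def by meson
    moreover from this have "A = {n. \<exists>a. P a n}" unfolding sat by blast
    ultimately show "{n. \<exists>a. P a n} \<in> sets M" by simp
  qed
qed

section \<open>Codes of finite sets\<close>

text \<open>Membership in the set that \<open>c\<close> describes. All witnesses, including the
  quotient, carry bounds, so the relation is bounded before any comprehension beyond
  \<open>\<Delta>\<^sup>0\<^sub>1\<close> is available.\<close>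

definition coded_in :: "'a \<Rightarrow> 'a \<Rightarrow> bool" where
  "coded_in i c \<longleftrightarrow> (\<exists>k. k \<prec> c \<oplus> \<one> \<and> (\<exists>m. m \<prec> c \<oplus> \<one> \<and> (\<exists>n. n \<prec> c \<oplus> \<one> \<and>
     (c = pair M k (pair M m n) \<and> i \<prec> k \<and>
       (\<exists>q. q \<prec> n \<oplus> \<one> \<and> n = (m \<otimes> (i \<oplus> \<one>) \<oplus> \<one>) \<otimes> q)))))"

text \<open>The divisor is a successor, hence nonzero, so the quotient cannot exceed
  \<open>n\<close>.\<close>

lemma divides_iff_bounded:
  "divides M (a \<oplus> \<one>) n \<longleftrightarrow> (\<exists>q. q \<prec> n \<oplus> \<one> \<and> n = (a \<oplus> \<one>) \<otimes> q)"
  unfolding divides_def using less_succ_mul[OF succ_neq_zero] mul_commute by metis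

lemma coded_in_pair:
  "coded_in i (pair M k (pair M m n)) \<longleftrightarrow> i \<prec> k \<and> divides M (m \<otimes> (i \<oplus> \<one>) \<oplus> \<one>) n"
proof
  let ?c = "pair M k (pair M m n)"
  have "k \<prec> ?c \<oplus> \<one>" "m \<prec> ?c \<oplus> \<one>" "n \<prec> ?c \<oplus> \<one>"
    by (rule pair_bounds less_succ_trans[OF pair_bounds(1) pair_bounds(2)]
        less_succ_trans[OF pair_bounds(2) pair_bounds(2)])+
  then show "i \<prec> k \<and> divides M (m \<otimes> (i \<oplus> \<one>) \<oplus> \<one>) n \<Longrightarrow> coded_in i ?c"
    unfolding coded_in_def divides_iff_bounded by blast
qed (auto simp: coded_in_def divides_iff_bounded pair_inject)

lemma describes_coded_in: "describes M c A \<Longrightarrow> i \<in> A \<longleftrightarrow> coded_in i c"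
  unfolding describes_def by (elim exE conjE) (simp only: coded_in_pair)

lemma coded_in_less: "coded_in i c \<Longrightarrow> i \<prec> c"
proof -
  assume "coded_in i c"
  then obtain k where "i \<prec> k" "k \<prec> c \<oplus> \<one>" unfolding coded_in_def by (elim exE conjE)
  then show ?thesis unfolding less_succ using less_trans by (elim disjE) simp_all
qed

lemma bounded_rel_coded_in:
  "poly_fun M t \<Longrightarrow> poly_fun M u \<Longrightarrow> bounded_rel M (\<lambda>e. coded_in (t e) (u e))"
proof -
  assume t: "poly_fun M t" "poly_fun M u"
  have "bounded_rel M (\<lambda>e. coded_in (e 0) (e (Suc 0)))"
    unfolding coded_in_def by (intro bounded_rel_intros poly_fun_intros)
  moreover have "poly_fun M (if i = 0 then t else u)" for i :: nat using t by simp
  ultimately show ?thesis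
    using bounded_rel_subst[where \<tau> = "\<lambda>i. if i = 0 then t else u" and M = M and P = "\<lambda>e. coded_in (e 0) (e (Suc 0))"]
    by simp
qed

section \<open>From codes of edges to comprehension\<close>

lemma sigma01_comprehension_if_coding:
  assumes coding: "finite_edge_coding M"
  shows sigma01_comprehension
  unfolding sigma01_comprehension_def
proof (intro allI impI)
  fix P
  assume P: "bounded_rel M (\<lambda>e. P (e 0) (e (Suc 0)))"
  have P_subst: "bounded_rel M (\<lambda>e. P (t e) (u e))" if "poly_fun M t" "poly_fun M u" for t u
  proof -
    have "poly_fun M (if i = 0 then t else u)" for i :: nat using that by simp
    then show ?thesis
      using bounded_rel_subst[OF P, of "\<lambda>i. if i = 0 then t else u"] by simp
  qed
  \<comment> \<open>Taking all witnesses might make an edge infinite; the least one alone keeps it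
    finite.\<close>
  define least where "least x n \<longleftrightarrow> P x n \<and> (\<forall>y. y \<prec> x \<longrightarrow> \<not> P y n)" for x n
  define edge where "edge v n \<longleftrightarrow> v = n \<oplus> n \<or> (\<exists>x. x \<prec> v \<and> (v = x \<oplus> x \<oplus> \<one> \<and> least x n))" for v n
  \<comment> \<open>The graph records the value 0 as well, since a characteristic function is total.
    The bounds on \<open>n\<close> and \<open>v\<close> hold automatically by
    \<open>pair_bounds\<close>.\<close>
  define \<chi> where "\<chi> = {z. \<exists>n. n \<prec> z \<oplus> \<one> \<and> (\<exists>v. v \<prec> z \<oplus> \<one> \<and>
    (edge v n \<and> z = pair M (pair M n v) \<one> \<or> \<not> edge v n \<and> z = pair M (pair M n v) \<zero>))}"
  have "bounded_rel M (\<lambda>e. \<exists>n. n \<prec> e 0 \<oplus> \<one> \<and> (\<exists>v. v \<prec> e 0 \<oplus> \<one> \<and>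
    (edge v n \<and> e 0 = pair M (pair M n v) \<one> \<or> \<not> edge v n \<and> e 0 = pair M (pair M n v) \<zero>)))"
    unfolding edge_def least_def by (intro bounded_rel_intros poly_fun_intros P_subst)
  then have \<chi>_sets: "\<chi> \<in> sets M" unfolding \<chi>_def by (rule bounded_comp)
  have \<chi>_iff: "z \<in> \<chi> \<longleftrightarrow> (\<exists>n v. edge v n \<and> z = pair M (pair M n v) \<one> \<or> \<not> edge v n \<and> z = pair M (pair M n v) \<zero>)" for z
  proof -
    have b: "n \<prec> pair M (pair M n v) b \<oplus> \<one>" "v \<prec> pair M (pair M n v) b \<oplus> \<one>" for n v b
      by (rule less_succ_trans[OF pair_bounds(1) pair_bounds(1)] less_succ_trans[OF pair_bounds(2) pair_bounds(1)])+
    show ?thesis unfolding \<chi>_def mem_Collect_eq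
    proof (intro iffI; elim exE)
      fix n v
      assume *: "edge v n \<and> z = pair M (pair M n v) \<one> \<or> \<not> edge v n \<and> z = pair M (pair M n v) \<zero>"
      then have "n \<prec> z \<oplus> \<one>" "v \<prec> z \<oplus> \<one>" using b by (elim disjE conjE; simp only:)+
      then show "\<exists>n. n \<prec> z \<oplus> \<one> \<and> (\<exists>v. v \<prec> z \<oplus> \<one> \<and>
        (edge v n \<and> z = pair M (pair M n v) \<one> \<or> \<not> edge v n \<and> z = pair M (pair M n v) \<zero>))"
        using * by (intro exI[of _ n] exI[of _ v] conjI)
    qed (elim conjE exE, intro exI, assumption)
  qed
  have \<chi>_pair: "pair M (pair M n v) b \<in> \<chi> \<longleftrightarrow> b = (if edge v n then \<one> else \<zero>)" for n v b
    unfolding \<chi>_iff by (auto simp: pair_inject)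
  have char_edge: "char_edge M \<chi> n = {v. edge v n}" for n
    unfolding char_edge_def \<chi>_pair using zero_neq_one by auto
  have "\<chi> \<subseteq> product M (product M UNIV UNIV) {\<zero>, \<one>}"
    unfolding \<chi>_iff subset_iff product_def by blast
  moreover have "\<exists>!b. pair M a b \<in> \<chi>" if "a \<in> product M UNIV UNIV" for a
    using that \<chi>_pair unfolding product_def by auto
  ultimately have hyper: "char_hypergraph M UNIV \<chi>"
    unfolding char_hypergraph_def is_function_def using \<chi>_sets by simp
  have least_unique: "x = y" if "least x n" "least y n" for x y n
    using that less_linear unfolding least_def by blast
  have fin: "finite_in M (char_edge M \<chi> n)" for n
  proof (cases "\<exists>x. least x n")
    case True
    then obtain x where x: "least x n" by blast
    have "v \<prec> n \<oplus> n \<oplus> (x \<oplus> x \<oplus> \<one>) \<oplus> \<one>" if "edge v n" for v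
      using that unfolding edge_def using least_unique[OF x] less_succ_add by metis
    then show ?thesis unfolding finite_in_def char_edge by blast
  next
    case False
    then have "v \<prec> n \<oplus> n \<oplus> \<one>" if "edge v n" for v
      using that less_succ unfolding edge_def by blast
    then show ?thesis unfolding finite_in_def char_edge by blast
  qed
  have "UNIV \<in> sets M" using bounded_comp[OF bounded_rel_const[of M True]] by simp
  then obtain c where c: "c \<in> sets M" "represented_by_codes M \<chi> c"
    using coding \<chi>_sets hyper fin unfolding finite_edge_coding_def by blast
  have edge_even: "edge (n \<oplus> n) m \<longleftrightarrow> m = n" for n m
    unfolding edge_def using double_inject double_neq_succ_double by metis
  have edge_odd: "edge (x \<oplus> x \<oplus> \<one>) n \<longleftrightarrow> least x n" for x n
  proof -
    have "x \<prec> x \<oplus> x \<oplus> \<one>" by (rule less_succ_add)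
    then show ?thesis
      unfolding edge_def succ_inject double_inject using double_neq_succ_double by metis
  qed
  have code_edge: "\<exists>m. \<forall>v. coded_in v d \<longleftrightarrow> edge v m" if "pair M j d \<in> c" for j d
    using that c(2) describes_coded_in unfolding represented_by_codes_def is_code_of_def char_edge by blast
  have edge_code: "\<exists>j d. pair M j d \<in> c \<and> (\<forall>v. coded_in v d \<longleftrightarrow> edge v m)" for m
    using c(2) describes_coded_in unfolding represented_by_codes_def is_code_of_def char_edge by blast
  have P_least: "(\<exists>x. P x n) \<longleftrightarrow> (\<exists>x. least x n)" for n
    using bounded_least[OF P_subst[OF poly_fun_var poly_fun_const]] unfolding least_def by blast
  \<comment> \<open>The bound on \<open>x\<close> loses nothing, because a coded element 2x + 1 is
    itself below \<open>d\<close>.\<close>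
  define odd_in where "odd_in d \<longleftrightarrow> (\<exists>x. x \<prec> d \<and> coded_in (x \<oplus> x \<oplus> \<one>) d)" for d
  have odd_in_iff: "odd_in d \<longleftrightarrow> (\<exists>x. P x n)" if "\<forall>v. coded_in v d \<longleftrightarrow> edge v n" for d n
  proof -
    have "x \<prec> d" if "coded_in (x \<oplus> x \<oplus> \<one>) d" for x
      using coded_in_less[OF that] less_succ_add(1)[of x x] less_trans by blast
    then show ?thesis unfolding odd_in_def P_least using that edge_odd by blast
  qed
  \<comment> \<open>A single number \<open>w\<close> bounds both the index and the code, which
    merges two unbounded quantifiers into one.\<close>
  define R where "R w n \<longleftrightarrow> (\<exists>j. j \<prec> w \<and> (\<exists>d. d \<prec> w \<and> (pair M j d \<in> c \<and> coded_in (n \<oplus> n) d \<and> odd_in d)))" for w n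
  define R' where "R' w n \<longleftrightarrow> (\<forall>j. j \<prec> w \<longrightarrow> (\<forall>d. d \<prec> w \<longrightarrow> (pair M j d \<in> c \<and> coded_in (n \<oplus> n) d \<longrightarrow> odd_in d)))" for w n
  have bdd: "\<exists>w. j \<prec> w \<and> d \<prec> w" for j d
    using less_succ_add by blast
  have R: "bounded_rel M (\<lambda>e. R (e 0) (e (Suc 0)))"
    unfolding R_def odd_in_def by (intro bounded_rel_intros poly_fun_intros bounded_rel_coded_in c)
  have R': "bounded_rel M (\<lambda>e. R' (e 0) (e (Suc 0)))"
    unfolding R'_def odd_in_def by (intro bounded_rel_intros poly_fun_intros bounded_rel_coded_in c)
  have code_of: "(\<exists>x. P x n) \<longleftrightarrow> odd_in d" if "pair M j d \<in> c" "coded_in (n \<oplus> n) d" for j d n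
    using code_edge[OF that(1)] that(2) edge_even odd_in_iff by metis
  have ex_code: "\<exists>j d. pair M j d \<in> c \<and> coded_in (n \<oplus> n) d" for n
    using edge_code[of n] edge_even by blast
  have R_iff: "(\<exists>w. R w n) \<longleftrightarrow> (\<exists>x. P x n)" for n
    unfolding R_def using code_of ex_code[of n] bdd by meson
  \<comment> \<open>The universal form agrees with the existential one: some code contains 2n, and
    every code containing 2n describes edge \<open>n\<close>.\<close>
  have R'_iff: "(\<forall>w. R' w n) \<longleftrightarrow> (\<exists>x. P x n)" for n
    unfolding R'_def using code_of ex_code[of n] bdd by meson
  have "{n. \<exists>w. R w n} \<in> sets M"
    by (rule delta01_comp[OF R R']) (simp add: R_iff R'_iff)
  then show "{n. \<exists>x. P x n} \<in> sets M" unfolding R_iff .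
qed

section \<open>From comprehension to codes of edges\<close>

lemma mul_succ_eq_zero: "a \<otimes> (b \<oplus> \<one>) = \<zero> \<longleftrightarrow> a = \<zero>"
  by (auto simp: mul_succ add_eq_zero mul_zero zero_mul)

text \<open>Replaces subtraction: if \<open>a\<close> is below \<open>b\<close>, then
  \<open>n\<close> is \<open>u\<close> times their difference; otherwise cancellation forces
  \<open>n\<close> to be zero.\<close>

lemma divides_cancel_add:
  assumes "n \<oplus> u \<otimes> a = u \<otimes> b"
  shows "divides M u n"
proof (cases "a \<prec> b")
  case True
  then obtain e where b: "b = a \<oplus> (e \<oplus> \<one>)" unfolding less_iff_ex_add add_assoc by blast
  have "u \<otimes> a \<oplus> n = u \<otimes> a \<oplus> u \<otimes> (e \<oplus> \<one>)"
    using assms unfolding b distrib_left[of u a] by (simp only: add_commute)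
  then show ?thesis unfolding divides_def add_left_cancel by blast
next
  case False
  then have "b \<prec> a \<oplus> \<one>" unfolding less_succ using less_linear by blast
  then obtain e where a: "a = b \<oplus> e" unfolding less_succ_iff_ex_add by blast
  have "u \<otimes> b \<oplus> (n \<oplus> u \<otimes> e) = u \<otimes> b \<oplus> \<zero>"
    using assms unfolding a distrib_left add_zero by (simp only: ar.add_ac)
  then have "n = \<zero>" unfolding add_left_cancel add_eq_zero by blast
  then show ?thesis unfolding divides_def using mul_zero by metis
qed

lemma divides_mul_right: "divides M u n \<Longrightarrow> divides M u (n \<otimes> v)"
  unfolding divides_def by (auto simp: mul_assoc)

text \<open>The moduli of Goedel's beta function, which are the divisors in
  \<open>describes\<close>.\<close>

definition modulus :: "'a \<Rightarrow> 'a \<Rightarrow> 'a" where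
  "modulus m i = m \<otimes> (i \<oplus> \<one>) \<oplus> \<one>"

text \<open>Bezout identities for \<open>m I + 1\<close> and \<open>m J + 1\<close>, where \<open>m\<close> is a multiple of the difference
  \<open>D\<close> of \<open>I\<close> and \<open>J\<close>; negative terms are moved to the other side.\<close>

lemma bezout_less:
  assumes "J = I \<oplus> D" "m = D \<otimes> q"
  shows "\<one> \<oplus> (m \<otimes> I \<oplus> \<one>) \<otimes> (q \<otimes> I \<otimes> J) = (m \<otimes> I \<oplus> \<one>) \<oplus> q \<otimes> I \<otimes> I \<otimes> (m \<otimes> J \<oplus> \<one>)"
  unfolding assms
  by (simp only: ar.distrib_left ar.distrib_right ar.mult_1_left ar.mult_1_right ar.add_ac ar.mult_ac)

lemma bezout_greater:
  assumes "I = J \<oplus> D" "m = D \<otimes> q"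
  shows "\<one> \<oplus> q \<otimes> I \<otimes> I \<otimes> (m \<otimes> J \<oplus> \<one>) = (m \<otimes> I \<oplus> \<one>) \<oplus> (m \<otimes> I \<oplus> \<one>) \<otimes> (q \<otimes> I \<otimes> J)"
  unfolding assms
  by (simp only: ar.distrib_left ar.distrib_right ar.mult_1_left ar.mult_1_right ar.add_ac ar.mult_ac)

text \<open>The difference of the two indices is some d + 1 with \<open>d\<close> below
  \<open>k\<close>, so it divides \<open>m\<close> and a Bezout identity applies. Multiplied by
  \<open>n\<close>, it shows \<open>n\<close> to be a difference of multiples of
  \<open>modulus m i\<close>, since the product with the other modulus is one by assumption.\<close>

lemma modulus_coprime:
  assumes "i \<noteq> j" "i \<prec> k" "j \<prec> k"
    and m: "\<And>d. d \<prec> k \<Longrightarrow> divides M (d \<oplus> \<one>) m"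
    and dvd: "divides M (modulus m i) (n \<otimes> modulus m j)"
  shows "divides M (modulus m i) n"
proof -
  define I J where "I = i \<oplus> \<one>" and "J = j \<oplus> \<one>"
  let ?u = "modulus m i" and ?v = "modulus m j"
  obtain t where t: "n \<otimes> ?v = ?u \<otimes> t" using dvd unfolding divides_def by blast
  consider "i \<prec> j" | "j \<prec> i" using assms(1) less_linear by blast
  then show ?thesis
  proof cases
    case 1
    then obtain d where j: "j = i \<oplus> d \<oplus> \<one>" unfolding less_iff_ex_add by blast
    have "d \<prec> j" unfolding j by (rule less_succ_add)
    then obtain q where q: "m = (d \<oplus> \<one>) \<otimes> q"
      using m less_trans assms(3) unfolding divides_def by blast
    have "\<one> \<oplus> ?u \<otimes> (q \<otimes> I \<otimes> J) = ?u \<oplus> q \<otimes> I \<otimes> I \<otimes> ?v"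
      unfolding modulus_def I_def J_def by (rule bezout_less[OF _ q]) (simp only: j ar.add_ac)
    then have "n \<otimes> (\<one> \<oplus> ?u \<otimes> (q \<otimes> I \<otimes> J)) = n \<otimes> (?u \<oplus> q \<otimes> I \<otimes> I \<otimes> ?v)" by (simp only:)
    then have "n \<oplus> ?u \<otimes> (n \<otimes> (q \<otimes> I \<otimes> J)) = ?u \<otimes> n \<oplus> q \<otimes> I \<otimes> I \<otimes> (n \<otimes> ?v)"
      by (simp only: ar.distrib_left[of n] ar.mult_ac ar.mult_1_right)
    also have "\<dots> = ?u \<otimes> (n \<oplus> q \<otimes> I \<otimes> I \<otimes> t)"
      unfolding t by (simp only: ar.distrib_left[of ?u] ar.mult_ac)
    finally show ?thesis by (rule divides_cancel_add)
  next
    case 2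
    then obtain d where i: "i = j \<oplus> d \<oplus> \<one>" unfolding less_iff_ex_add by blast
    have "d \<prec> i" unfolding i by (rule less_succ_add)
    then obtain q where q: "m = (d \<oplus> \<one>) \<otimes> q"
      using m less_trans assms(2) unfolding divides_def by blast
    have "\<one> \<oplus> q \<otimes> I \<otimes> I \<otimes> ?v = ?u \<oplus> ?u \<otimes> (q \<otimes> I \<otimes> J)"
      unfolding modulus_def I_def J_def by (rule bezout_greater[OF _ q]) (simp only: i ar.add_ac)
    then have "n \<otimes> (\<one> \<oplus> q \<otimes> I \<otimes> I \<otimes> ?v) = n \<otimes> (?u \<oplus> ?u \<otimes> (q \<otimes> I \<otimes> J))" by (simp only:)
    then have "n \<oplus> q \<otimes> I \<otimes> I \<otimes> (n \<otimes> ?v) = ?u \<otimes> n \<oplus> ?u \<otimes> (n \<otimes> (q \<otimes> I \<otimes> J))"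
      by (simp only: ar.distrib_left[of n] ar.mult_ac ar.mult_1_right)
    then have "n \<oplus> ?u \<otimes> (q \<otimes> I \<otimes> I \<otimes> t) = ?u \<otimes> (n \<oplus> n \<otimes> (q \<otimes> I \<otimes> J))"
      unfolding t by (simp only: ar.distrib_left[of ?u] ar.mult_ac)
    then show ?thesis by (rule divides_cancel_add)
  qed
qed

text \<open>For nonzero \<open>m\<close> the modulus exceeds 1. This makes the empty product a
  description of the empty set.\<close>

lemma not_divides_one:
  assumes "m \<noteq> \<zero>"
  shows "\<not> divides M (modulus m i) \<one>"
proof
  assume "divides M (modulus m i) \<one>"
  then obtain q where q: "\<one> = modulus m i \<otimes> q" unfolding divides_def by blast
  then have "q \<noteq> \<zero>" using zero_neq_one mul_zero by metis
  then obtain r where "q = r \<oplus> \<one>" using zero_or_succ by blast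
  then have "modulus m i \<otimes> q = modulus m i \<otimes> r \<oplus> m \<otimes> (i \<oplus> \<one>) \<oplus> \<one>"
    by (simp only: mul_succ[of _ r] add_assoc) (simp only: modulus_def)
  then have "\<zero> \<oplus> \<one> = modulus m i \<otimes> r \<oplus> m \<otimes> (i \<oplus> \<one>) \<oplus> \<one>"
    unfolding q[symmetric] zero_add .
  then have "m \<otimes> (i \<oplus> \<one>) = \<zero>"
    unfolding succ_inject using add_eq_zero by metis
  then show False using assms mul_succ_eq_zero by blast
qed

text \<open>The witness grows like a factorial, by the factor k + 1 in each step. Its quantifier is
  unbounded, but under \<open>comp\<close> the statement is still a bounded relation, so
  \<open>bounded_induct\<close> applies.\<close>

lemma ex_common_multiple:
  assumes comp: sigma01_comprehension
  shows "\<exists>m. m \<noteq> \<zero> \<and> (\<forall>d. d \<prec> k \<longrightarrow> divides M (d \<oplus> \<one>) m)"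
proof (induction k rule: bounded_induct)
  case bounded
  show ?case unfolding divides_def
    by (intro bounded_rel_intros bounded_rel_ex[OF comp] poly_fun_intros)
next
  case zero
  show ?case using not_less_zero zero_neq_one by metis
next
  case (succ k)
  then obtain m where m: "m \<noteq> \<zero>" "\<And>d. d \<prec> k \<Longrightarrow> divides M (d \<oplus> \<one>) m" by blast
  have "divides M (d \<oplus> \<one>) (m \<otimes> (k \<oplus> \<one>))" if "d \<prec> k \<oplus> \<one>" for d
  proof (cases "d = k")
    case True
    then show ?thesis unfolding divides_def using mul_commute by blast
  next
    case False
    then have "d \<prec> k" using that less_succ by blast
    then show ?thesis by (intro divides_mul_right m)
  qed
  moreover have "m \<otimes> (k \<oplus> \<one>) \<noteq> \<zero>" using m mul_succ_eq_zero by blast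
  ultimately show ?case by blast
qed

lemma ex_describes:
  assumes comp: sigma01_comprehension and A: "A \<in> sets M" and "finite_in M A"
  shows "\<exists>c. describes M c A"
proof -
  obtain k where k: "\<And>i. i \<in> A \<Longrightarrow> i \<prec> k" using assms(3) unfolding finite_in_def by blast
  obtain m where m: "m \<noteq> \<zero>" "\<And>d. d \<prec> k \<Longrightarrow> divides M (d \<oplus> \<one>) m"
    using ex_common_multiple[OF comp] by blast
  \<comment> \<open>Here \<open>n\<close> is the product of the moduli of the elements of the set
    below \<open>j\<close>: it starts at 1 and gains the factor \<open>modulus m j\<close> when
    \<open>j\<close> belongs to the set.\<close>
  have "\<exists>n. \<forall>i. i \<prec> k \<longrightarrow> (divides M (modulus m i) n \<longleftrightarrow> i \<in> A \<and> i \<prec> j)" for j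
  proof (induction j rule: bounded_induct)
    case bounded
    show ?case unfolding divides_def modulus_def
      by (intro bounded_rel_intros bounded_rel_ex[OF comp] poly_fun_intros A)
  next
    case zero
    show ?case using not_divides_one[OF m(1)] not_less_zero by blast
  next
    case (succ j)
    then obtain n where n: "\<And>i. i \<prec> k \<Longrightarrow> divides M (modulus m i) n \<longleftrightarrow> i \<in> A \<and> i \<prec> j" by blast
    show ?case
    proof (cases "j \<in> A")
      case False
      then have "i \<in> A \<and> i \<prec> j \<oplus> \<one> \<longleftrightarrow> i \<in> A \<and> i \<prec> j" for i using less_succ by blast
      then show ?thesis using n by (intro exI[of _ n]) simp
    next
      case True
      have "divides M (modulus m i) (n \<otimes> modulus m j) \<longleftrightarrow> i \<in> A \<and> i \<prec> j \<oplus> \<one>" if i: "i \<prec> k" for i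
      proof (cases "i = j")
        case True
        then show ?thesis using \<open>j \<in> A\<close> less_succ mul_commute unfolding divides_def by blast
      next
        case False
        then have "divides M (modulus m i) (n \<otimes> modulus m j) \<longleftrightarrow> divides M (modulus m i) n"
          using modulus_coprime[OF False i k[OF \<open>j \<in> A\<close>] m(2)] divides_mul_right by blast
        then show ?thesis using n[OF i] False less_succ by simp
      qed
      then show ?thesis by blast
    qed
  qed
  then obtain n where "\<forall>i. i \<prec> k \<longrightarrow> (divides M (modulus m i) n \<longleftrightarrow> i \<in> A \<and> i \<prec> k)" by blast
  then have "i \<in> A \<longleftrightarrow> i \<prec> k \<and> divides M (m \<otimes> (i \<oplus> \<one>) \<oplus> \<one>) n" for i
    using k[of i] unfolding modulus_def by blast
  then have "describes M (pair M k (pair M m n)) A"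
    unfolding describes_def by (intro exI[of _ k] exI[of _ m] exI[of _ n]) simp
  then show ?thesis by blast
qed

text \<open>Under \<open>comp\<close> being a description of the set is a bounded relation, so the
  least number principle picks the code.\<close>

lemma ex1_code:
  assumes comp: sigma01_comprehension and A: "A \<in> sets M" and "finite_in M A"
  shows "\<exists>!c. is_code_of M c A"
proof -
  have "bounded_rel M (\<lambda>e. describes M (e 0) A)"
    unfolding describes_def divides_def
    by (intro bounded_rel_intros bounded_rel_ex[OF comp] bounded_rel_all[OF comp] poly_fun_intros A)
  then have "\<exists>c. is_code_of M c A"
    using ex_describes[OF assms] bounded_least[where P = "\<lambda>c. describes M c A"]
    unfolding is_code_of_def by blast
  moreover have "c = d" if "is_code_of M c A" "is_code_of M d A" for c d
    using that less_linear[of c d] unfolding is_code_of_def by blast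
  ultimately show ?thesis by blast
qed

lemma coding_if_sigma01_comprehension:
  assumes comp: sigma01_comprehension
  shows "finite_edge_coding M"
  unfolding finite_edge_coding_def
proof (intro ballI impI, elim conjE)
  fix V \<chi>
  assume \<chi>: "\<chi> \<in> sets M" and fin: "\<forall>i. finite_in M (char_edge M \<chi> i)"
  let ?code = "\<lambda>i d. is_code_of M d (char_edge M \<chi> i)"
  \<comment> \<open>The enumeration of the edges is kept: term \<open>i\<close> is the code of edge
    \<open>i\<close>.\<close>
  define c where "c = {z. \<exists>i d. z = pair M i d \<and> ?code i d}"
  have "bounded_rel M (\<lambda>e. \<exists>i d. e 0 = pair M i d \<and> ?code i d)"
    unfolding is_code_of_def describes_def divides_def char_edge_def mem_Collect_eq
    by (intro bounded_rel_intros bounded_rel_ex[OF comp] bounded_rel_all[OF comp] poly_fun_intros \<chi>)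
  then have c_sets: "c \<in> sets M" unfolding c_def by (rule bounded_comp)
  have c_iff: "pair M i d \<in> c \<longleftrightarrow> ?code i d" for i d
    unfolding c_def by (auto simp: pair_inject)
  have "char_edge M \<chi> i \<in> sets M" for i
    unfolding char_edge_def by (rule bounded_comp) (intro bounded_rel_intros poly_fun_intros \<chi>)
  then have ex1: "\<exists>!d. ?code i d" for i using ex1_code[OF comp] fin by simp
  have "c \<subseteq> product M UNIV UNIV" unfolding c_def product_def by blast
  then have "is_function M c UNIV UNIV"
    unfolding is_function_def c_iff using c_sets ex1 by simp
  moreover have "\<exists>j d. ?code j d \<and> ?code i d" for i using ex1[of i] by blast
  ultimately have "represented_by_codes M \<chi> c"
    unfolding represented_by_codes_def c_iff by blast
  then show "\<exists>c\<in>sets M. represented_by_codes M \<chi> c" using c_sets by blast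
qed

end

theorem theorem4:
  fixes M :: "'a structure2"
  assumes "RCA0_model M"
  shows "ACA0_model M \<longleftrightarrow> finite_edge_coding M"
proof -
  interpret rca0 M by unfold_locales (rule assms)
  show ?thesis
    using assms sigma01_comprehension_if_coding coding_if_sigma01_comprehension
      arithmetical_comprehension_iff_sigma01
    unfolding ACA0_model_def by blast
qed

end
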